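(* Let $F:\mathbb{R}^n\to\mathbb{R}^m$ and $\mathbb{L}:\mathbb{R}^m\to\mathbb{R}$ be the inner and outer functions of a sigmoid network problem $\min_{\theta\in\mathbb{R}^n}\mathbb{L}(F(\theta))$ (see context). Let $\beta\in[1,2)$ and $r>0$. Let $\{\theta_k\}$ be a sequence generated by the globalized linearized proximal algorithm (GLPA), and let $\{\theta_k\}$ have a cluster point $\theta^*$ such that $C_{\mathbb{L}}$ is the set of weak sharp minima of order $\beta$ for $\mathbb{L}$ on the open ball $B(F(\theta^* ),r)$. If $\theta^*$ is a regular point of the inclusion $F(\theta)\in C_{\mathbb{L}}$, then $\{\theta_k\}$ converges at a rate of $\frac{2}{\beta}$ to $\theta^*$, which is a globally optimal solution of $\min_{\theta\in\mathbb{R}^n}\mathbb{L}(F(\theta))$, and $F(\theta^* )\in C_{\mathbb{L}}$.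
   Context: **Sigmoid network.** Let $\sigma(a)=1/(1+e^{-a})$. For parameters $\theta=(w_1,\dots,w_q,v_1,\dots,v_q,u_1,\dots,u_q,w_0)\in\mathbb{R}^n$, where $w_i,u_i,w_0\in\mathbb{R}$, $v_i\in\mathbb{R}^d$ and $n=(d+2)q+1$, set $f(x;\theta)=\sum_{i=1}^q w_i\,\sigma(v_i\cdot x+u_i)+w_0$ for $x\in\mathbb{R}^d$. Training data $(x_i,y_i)\in\mathbb{R}^d\times\mathbb{R}$, $i=1,\dots,m$, are given. **Inner and outer functions.** Training the network is written as $\min_{\theta\in\mathbb{R}^n}\mathbb{L}(F(\theta))$ with $F:\mathbb{R}^n\to\mathbb{R}^m$ smooth and $\mathbb{L}:\mathbb{R}^m\to\mathbb{R}$ convex. Specifically: for the quadratic ($p=2$) or absolute ($p=1$) loss, $F(\theta)=(f(x_i;\theta)-y_i)_{i=1}^m$ and $\mathbb{L}(z)=\frac1m\|z\|_p^p$; for the hinge loss, $F(\theta)=(y_if(x_i;\theta))_{i=1}^m$ and $\mathbb{L}(z)=\frac1m\sum_{i=1}^m\max(1-z_i,0)$. In all these cases $\mathbb{L}(z)=\frac1m\sum_{i=1}^m\ell(z_i)$ with $\ell:\mathbb{R}\to[0,\infty)$ convex. $F'(\theta)\in\mathbb{R}^{m\times n}$ is the Jacobian matrix of $F$, $\|\cdot\|$ is the Euclidean norm, and $B(z,r)$ is the open ball of radius $r$ centered at $z$. **GLPA.** Given $t>0$, $c,\tau\in(0,1)$ and $\theta_0\in\mathbb{R}^n$, for $k=0,1,2,\dots$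 let $$\Delta\theta_k=\arg\min_{\Delta\theta\in\mathbb{R}^n}\Big\{\mathbb{L}(F(\theta_k)+F'(\theta_k)\Delta\theta)+\tfrac1{2t}\|\Delta\theta\|^2\Big\};$$ stop if $\Delta\theta_k=0$. Otherwise let $\eta_k$ be the first $\eta$ in the list $1,\tau,\tau^2,\dots$ such that $$\mathbb{L}(F(\theta_k+\eta\Delta\theta_k))-\mathbb{L}(F(\theta_k))\le c\,\eta\Big(\mathbb{L}(F(\theta_k)+F'(\theta_k)\Delta\theta_k)+\tfrac1{2t}\|\Delta\theta_k\|^2-\mathbb{L}(F(\theta_k))\Big),$$ and set $\theta_{k+1}=\theta_k+\eta_k\Delta\theta_k$. **Minima.** $\mathbb{L}_{\min}=\min_{z\in\mathbb{R}^m}\mathbb{L}(z)$ and $C_{\mathbb{L}}=\arg\min_{z\in\mathbb{R}^m}\mathbb{L}(z)$. **Weak sharp minima.** Let $C_{\mathbb{L}}\subseteq S\subseteq\mathbb{R}^m$. If there exist $\alpha>0$ and $\beta\ge1$ such that $\mathbb{L}(z)\ge\mathbb{L}_{\min}+\alpha\,\mathrm{dist}^\beta(z,C_{\mathbb{L}})$ for each $z\in S$, where $\mathrm{dist}(z,C)=\inf_{c\in C}\|z-c\|$, then $C_{\mathbb{L}}$ is called the set of weak sharp minima of order $\beta$ for $\mathbb{L}$ on $S$ with modulus $\alpha$. **Regular point.** $\bar\theta$ is a regular point of the inclusion $F(\theta)\in C_{\mathbb{L}}$ if $\ker(F'(\bar\theta)^T)\cap(C_{\mathbb{L}}-F(\bar\theta))^{\ominus}=\{0\}$,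 where $Z^{\ominus}=\{y:\langle y,z\rangle\le0\ \forall z\in Z\}$ is the negative polar of $Z$. **Rate.** "Rate of $2/\beta$" refers to the order of convergence (for example, rate $2$ is quadratic convergence); no more specific definition is fixed. *)

theory Defs
  imports "HOL-Analysis.Analysis"
begin

section \<open>Sigmoid networks\<close>

definition sigmoid :: "real \<Rightarrow> real" where
  "sigmoid a = 1 / (1 + exp (- a))"

text \<open>
  The parameter vector is a vector of the Euclidean space of dimension
  \<open>n = (d + 2) q + 1\<close> with \<open>d = CARD('d)\<close> and \<open>q = CARD('q)\<close>.  Its index type is the
  disjoint sum of the index sets of \<open>w\<^sub>1, \<dots>, w\<^sub>q\<close>, of the components of
  \<open>v\<^sub>1, \<dots>, v\<^sub>q\<close>, of \<open>u\<^sub>1, \<dots>, u\<^sub>q\<close>, and of \<open>w\<^sub>0\<close>, in this order.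
\<close>

type_synonym ('d, 'q) param_index = "'q + ('q \<times> 'd) + 'q + unit"

type_synonym ('d, 'q) params = "(real, ('d, 'q) param_index) vec"

definition par_w :: "('d::finite, 'q::finite) params \<Rightarrow> 'q \<Rightarrow> real" where
  "par_w \<theta> i = \<theta> $ Inl i"

definition par_v :: "('d::finite, 'q::finite) params \<Rightarrow> 'q \<Rightarrow> real ^ 'd" where
  "par_v \<theta> i = (\<chi> j. \<theta> $ Inr (Inl (i, j)))"

definition par_u :: "('d::finite, 'q::finite) params \<Rightarrow> 'q \<Rightarrow> real" where
  "par_u \<theta> i = \<theta> $ Inr (Inr (Inl i))"

definition par_w0 :: "('d::finite, 'q::finite) params \<Rightarrow> real" where
  "par_w0 \<theta> = \<theta> $ Inr (Inr (Inr ()))"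

definition network :: "('d::finite, 'q::finite) params \<Rightarrow> real ^ 'd \<Rightarrow> real" where
  "network \<theta> x = (\<Sum>i\<in>UNIV. par_w \<theta> i * sigmoid (par_v \<theta> i \<bullet> x + par_u \<theta> i)) + par_w0 \<theta>"

datatype loss = Quadratic | Absolute | Hinge

fun inner_fun :: "loss \<Rightarrow> ('m::finite \<Rightarrow> real ^ 'd) \<Rightarrow> ('m \<Rightarrow> real) \<Rightarrow>
    ('d::finite, 'q::finite) params \<Rightarrow> real ^ 'm" where
  "inner_fun Quadratic x y \<theta> = (\<chi> i. network \<theta> (x i) - y i)"
| "inner_fun Absolute x y \<theta> = (\<chi> i. network \<theta> (x i) - y i)"
| "inner_fun Hinge x y \<theta> = (\<chi> i. y i * network \<theta> (x i))"

fun outer_fun :: "loss \<Rightarrow> real ^ 'm::finite \<Rightarrow> real" where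
  "outer_fun Quadratic z = (\<Sum>i\<in>UNIV. \<bar>z $ i\<bar> ^ 2) / real CARD('m)"
| "outer_fun Absolute z = (\<Sum>i\<in>UNIV. \<bar>z $ i\<bar>) / real CARD('m)"
| "outer_fun Hinge z = (\<Sum>i\<in>UNIV. max (1 - z $ i) 0) / real CARD('m)"


section \<open>Minima, weak sharp minima and regular points\<close>

definition argmin_set :: "('a \<Rightarrow> real) \<Rightarrow> 'a set" where
  "argmin_set f = {z. is_arg_min f (\<lambda>_. True) z}"

text \<open>
  The set \<open>S\<close> has to contain the set of minimizers.  On the minimizers themselves the
  growth inequality holds trivially.  Hence, for a set \<open>B\<close> that need not contain all
  minimizers (such as a ball, when the set of minimizers is unbounded, as for the hinge
  loss), weak sharpness on \<open>B\<close> is expressed by taking \<open>S = B \<union> argmin_set L\<close>, which adds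
  no requirement beyond the growth inequality on \<open>B\<close>.
\<close>

definition weak_sharp_minima :: "('a::metric_space \<Rightarrow> real) \<Rightarrow> real \<Rightarrow> 'a set \<Rightarrow> bool" where
  "weak_sharp_minima L \<beta> S \<longleftrightarrow> argmin_set L \<subseteq> S \<and> \<beta> \<ge> 1 \<and>
     (\<exists>\<alpha>>0. \<forall>z\<in>S. L z \<ge> (INF z'. L z') + \<alpha> * infdist z (argmin_set L) powr \<beta>)"

definition neg_polar :: "'a::real_inner set \<Rightarrow> 'a set" where
  "neg_polar Z = {y. \<forall>z\<in>Z. y \<bullet> z \<le> 0}"

text \<open>\<open>regular_point F C \<theta>\<close>: \<open>\<theta>\<close> is a regular point of the inclusion \<open>F \<theta> \<in> C\<close>.\<close>

definition regular_point :: "(real ^ 'n \<Rightarrow> real ^ 'm) \<Rightarrow> (real ^ 'm) set \<Rightarrow> real ^ 'n \<Rightarrow> bool" where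
  "regular_point F C \<theta> \<longleftrightarrow>
     {y. transpose (jacobian F (at \<theta>)) *v y = 0} \<inter> neg_polar ((\<lambda>c. c - F \<theta>) ` C) = {0}"


section \<open>The globalized linearized proximal algorithm\<close>

definition prox_model ::
  "(real ^ 'm \<Rightarrow> real) \<Rightarrow> (real ^ 'n \<Rightarrow> real ^ 'm) \<Rightarrow> real \<Rightarrow> real ^ 'n \<Rightarrow> real ^ 'n \<Rightarrow> real" where
  "prox_model L F t \<theta> \<Delta> = L (F \<theta> + jacobian F (at \<theta>) *v \<Delta>) + 1 / (2 * t) * (norm \<Delta>)\<^sup>2"

definition line_search_ok ::
  "(real ^ 'm \<Rightarrow> real) \<Rightarrow> (real ^ 'n \<Rightarrow> real ^ 'm) \<Rightarrow> real \<Rightarrow> real \<Rightarrow>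
    real ^ 'n \<Rightarrow> real ^ 'n \<Rightarrow> real \<Rightarrow> bool" where
  "line_search_ok L F t c \<theta> \<Delta> \<eta> \<longleftrightarrow>
     L (F (\<theta> + \<eta> *\<^sub>R \<Delta>)) - L (F \<theta>) \<le> c * \<eta> * (prox_model L F t \<theta> \<Delta> - L (F \<theta>))"

text \<open>
  A run that stops at step \<open>k\<close> is represented by the infinite sequence that stays
  constant from \<open>\<theta> k\<close> on.
\<close>

definition glpa_sequence ::
  "(real ^ 'm \<Rightarrow> real) \<Rightarrow> (real ^ 'n \<Rightarrow> real ^ 'm) \<Rightarrow> real \<Rightarrow> real \<Rightarrow> real \<Rightarrow>
    (nat \<Rightarrow> real ^ 'n) \<Rightarrow> bool" where
  "glpa_sequence L F t c \<tau> \<theta> \<longleftrightarrow>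
     (\<forall>k. \<exists>\<Delta>. is_arg_min (prox_model L F t (\<theta> k)) (\<lambda>_. True) \<Delta> \<and>
        (if \<Delta> = 0 then \<theta> (Suc k) = \<theta> k
         else \<exists>j. line_search_ok L F t c (\<theta> k) \<Delta> (\<tau> ^ j) \<and>
                  (\<forall>i<j. \<not> line_search_ok L F t c (\<theta> k) \<Delta> (\<tau> ^ i)) \<and>
                  \<theta> (Suc k) = \<theta> k + \<tau> ^ j *\<^sub>R \<Delta>))"

text \<open>Convergence with (Q-)order at least \<open>p\<close>, for \<open>p > 1\<close>; \<open>p = 2\<close> is quadratic convergence.\<close>

definition converges_with_order :: "(nat \<Rightarrow> 'a::real_normed_vector) \<Rightarrow> 'a \<Rightarrow> real \<Rightarrow> bool" where
  "converges_with_order X l p \<longleftrightarrow> X \<longlonglongrightarrow> l \<and>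
     (\<exists>C>0. \<forall>\<^sub>F k in sequentially. norm (X (Suc k) - l) \<le> C * norm (X k - l) powr p)"

end

theory Submission
  imports Defs
begin

text \<open>
  The argument works for every convex \<open>L\<close> with a minimizer and every \<open>F\<close> with locally Lipschitz
  derivative.  Near a point of the run the line search accepts all sufficiently small steps, so at
  the cluster point the proximal model admits no decrease; with regularity this forces
  \<open>F \<theta>star \<in> argmin_set L\<close>.  Regularity moreover gives, for \<open>b\<close> near \<open>\<theta>star\<close>, a solution \<open>d\<close> of
  the linearized inclusion \<open>F b + F' b d \<in> argmin_set L\<close> whose norm is at most a constant times the
  residual \<open>D = dist (F b, argmin_set L)\<close>.  Comparing the proximal step with \<open>d\<close> bounds its length by
  \<open>O(D)\<close> and the gap of \<open>L\<close> after linearization by \<open>O(D\<^sup>2)\<close>, so weak sharpness bounds the new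
  residual by \<open>O(D powr (2 / \<beta>))\<close>.  Since the current gap is at least of order \<open>D powr \<beta>\<close> and
  \<open>\<beta> < 2\<close>, the unit step is eventually accepted.
\<close>

section \<open>Functions with locally Lipschitz derivative\<close>

text \<open>Encoded with an explicit derivative map \<open>f'\<close> instead of a Jacobian matrix,
  so that sums and products stay elementary. The Lipschitz constant may depend on \<open>R\<close>:
  the derivative of a hidden unit contains its outer weight as a factor.\<close>

definition C11 :: "('a::real_normed_vector \<Rightarrow> 'b::real_normed_vector) \<Rightarrow> bool" where
  "C11 f \<longleftrightarrow> (\<exists>f'. (\<forall>a. (f has_derivative f' a) (at a)) \<and>
     (\<forall>R. \<exists>K. \<forall>a\<in>cball 0 R. \<forall>b\<in>cball 0 R. \<forall>h.
        norm (f' a h - f' b h) \<le> K * norm (a - b) * norm h))"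

lemma C11_const: "C11 (\<lambda>_. b)"
  unfolding C11_def by (intro exI[of _ "\<lambda>_ _. 0"]) (auto intro: exI[of _ 0])

lemma C11_add:
  assumes "C11 f" "C11 g"
  shows "C11 (\<lambda>a. f a + g a)"
proof -
  obtain f' where f': "\<And>a. (f has_derivative f' a) (at a)"
    and fK: "\<And>R. \<exists>K. \<forall>a\<in>cball 0 R. \<forall>b\<in>cball 0 R. \<forall>h.
        norm (f' a h - f' b h) \<le> K * norm (a - b) * norm h"
    using assms(1) unfolding C11_def by blast
  obtain g' where g': "\<And>a. (g has_derivative g' a) (at a)"
    and gK: "\<And>R. \<exists>K. \<forall>a\<in>cball 0 R. \<forall>b\<in>cball 0 R. \<forall>h.
        norm (g' a h - g' b h) \<le> K * norm (a - b) * norm h"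
    using assms(2) unfolding C11_def by blast
  have "\<exists>K. \<forall>a\<in>cball 0 R. \<forall>b\<in>cball 0 R. \<forall>h.
      norm ((f' a h + g' a h) - (f' b h + g' b h)) \<le> K * norm (a - b) * norm h" for R
  proof -
    obtain Kf Kg where Kf: "\<forall>a\<in>cball 0 R. \<forall>b\<in>cball 0 R. \<forall>h.
        norm (f' a h - f' b h) \<le> Kf * norm (a - b) * norm h"
      and Kg: "\<forall>a\<in>cball 0 R. \<forall>b\<in>cball 0 R. \<forall>h.
        norm (g' a h - g' b h) \<le> Kg * norm (a - b) * norm h"
      using fK gK by meson
    have "norm ((f' a h + g' a h) - (f' b h + g' b h)) \<le> (Kf + Kg) * norm (a - b) * norm h"
      if "a \<in> cball 0 R" "b \<in> cball 0 R" for a b h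
    proof -
      have "norm ((f' a h + g' a h) - (f' b h + g' b h))
          \<le> norm (f' a h - f' b h) + norm (g' a h - g' b h)"
        by (rule norm_diff_triangle_ineq)
      also have "\<dots> \<le> Kf * norm (a - b) * norm h + Kg * norm (a - b) * norm h"
        using Kf Kg that by (intro add_mono) blast+
      finally show ?thesis by (simp add: algebra_simps)
    qed
    then show ?thesis by blast
  qed
  then show ?thesis
    unfolding C11_def using f' g'
    by (intro exI[of _ "\<lambda>a h. f' a h + g' a h"]) (auto intro: has_derivative_add)
qed

lemma C11_bounded_linear_compose:
  assumes "bounded_linear l" "C11 f"
  shows "C11 (\<lambda>a. l (f a))"
proof -
  obtain f' where f': "\<And>a. (f has_derivative f' a) (at a)"
    and fK: "\<And>R. \<exists>K. \<forall>a\<in>cball 0 R. \<forall>b\<in>cball 0 R. \<forall>h.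
        norm (f' a h - f' b h) \<le> K * norm (a - b) * norm h"
    using assms(2) unfolding C11_def by blast
  obtain M where "M > 0" and M: "\<And>v. norm (l v) \<le> norm v * M"
    using bounded_linear.pos_bounded[OF assms(1)] by blast
  have "\<exists>K. \<forall>a\<in>cball 0 R. \<forall>b\<in>cball 0 R. \<forall>h.
      norm (l (f' a h) - l (f' b h)) \<le> K * norm (a - b) * norm h" for R
  proof -
    obtain K where K: "\<forall>a\<in>cball 0 R. \<forall>b\<in>cball 0 R. \<forall>h.
        norm (f' a h - f' b h) \<le> K * norm (a - b) * norm h"
      using fK by meson
    have "norm (l (f' a h) - l (f' b h)) \<le> (K * M) * norm (a - b) * norm h"
      if "a \<in> cball 0 R" "b \<in> cball 0 R" for a b h
    proof -
      have "norm (l (f' a h) - l (f' b h)) \<le> norm (f' a h - f' b h) * M"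
        using M by (metis assms(1) linear_diff bounded_linear.linear)
      also have "\<dots> \<le> (K * norm (a - b) * norm h) * M"
        using K that \<open>M > 0\<close> by (intro mult_right_mono) auto
      finally show ?thesis by (simp add: algebra_simps)
    qed
    then show ?thesis by blast
  qed
  then show ?thesis
    unfolding C11_def using bounded_linear.has_derivative[OF assms(1) f']
    by (intro exI[of _ "\<lambda>a h. l (f' a h)"]) auto
qed

lemma C11_bounded_linear:
  assumes "bounded_linear l"
  shows "C11 l"
  unfolding C11_def using bounded_linear_imp_has_derivative[OF assms]
  by (intro exI[of _ "\<lambda>_. l"]) (auto intro: exI[of _ 0])

lemma C11_sum:
  assumes "\<And>i. i \<in> I \<Longrightarrow> C11 (f i)"
  shows "C11 (\<lambda>a. \<Sum>i\<in>I. f i a)"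
  \<comment> \<open>An infinite \<open>I\<close> makes the sum \<open>0\<close>, which
    \<open>C11_const\<close> covers.\<close>
  using assms by (induction I rule: infinite_finite_induct) (auto intro: C11_const C11_add)

lemma C11_vec:
  fixes f :: "'m::finite \<Rightarrow> 'a::real_normed_vector \<Rightarrow> real"
  assumes "\<And>i. C11 (f i)"
  shows "C11 (\<lambda>a. \<chi> i. f i a)"
proof -
  \<comment> \<open>Expansion in the unit vectors: each summand is a scalar function followed by the
    bounded linear map that scales a fixed vector.\<close>
  have "(\<lambda>a. \<chi> i. f i a) = (\<lambda>a. \<Sum>i\<in>UNIV. f i a *\<^sub>R axis i 1)"
    by (auto simp: vec_eq_iff axis_def if_distrib sum.delta cong: if_cong)
  then show ?thesis
    using assms by (auto intro!: C11_sum C11_bounded_linear_compose[OF bounded_linear_scaleR_left])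
qed

section \<open>The network and the outer functions\<close>

lemma sigmoid_bounds: "0 < sigmoid a" "sigmoid a < 1"
  by (auto simp: sigmoid_def divide_simps add_pos_pos)

lemma sigmoid_has_real_derivative:
  "(sigmoid has_real_derivative sigmoid a * (1 - sigmoid a)) (at a)"
proof -
  have "1 + exp (- a) \<noteq> 0"
    using exp_gt_zero[of "- a"] by linarith
  then show ?thesis
    unfolding sigmoid_def [abs_def]
    by (auto intro!: derivative_eq_intros simp: divide_simps power2_eq_square algebra_simps)
qed

lemma abs_sigmoid_deriv_le: "\<bar>sigmoid a * (1 - sigmoid a)\<bar> \<le> 1"
  using sigmoid_bounds[of a] by (simp add: abs_mult mult_le_one)

lemma sigmoid_lipschitz: "\<bar>sigmoid a - sigmoid b\<bar> \<le> \<bar>a - b\<bar>"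
  using field_differentiable_bound[of UNIV sigmoid "\<lambda>a. sigmoid a * (1 - sigmoid a)" 1 a b]
    sigmoid_has_real_derivative abs_sigmoid_deriv_le by simp

text \<open>With \<open>s\<close> and \<open>s'\<close> the two sigmoid values, the difference
  factors as \<open>(s - s') * (1 - s - s')\<close>, and the second factor lies between -1 and
  1.\<close>

lemma sigmoid_deriv_lipschitz:
  "\<bar>sigmoid a * (1 - sigmoid a) - sigmoid b * (1 - sigmoid b)\<bar> \<le> \<bar>a - b\<bar>"
proof -
  have "\<bar>sigmoid a * (1 - sigmoid a) - sigmoid b * (1 - sigmoid b)\<bar>
      = \<bar>sigmoid a - sigmoid b\<bar> * \<bar>1 - sigmoid a - sigmoid b\<bar>"
    by (simp add: abs_mult[symmetric] algebra_simps)
  also have "\<dots> \<le> \<bar>sigmoid a - sigmoid b\<bar> * 1"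
    using sigmoid_bounds[of a] sigmoid_bounds[of b] by (intro mult_left_mono) auto
  also have "\<dots> \<le> \<bar>a - b\<bar>"
    using sigmoid_lipschitz[of a b] by simp
  finally show ?thesis .
qed

text \<open>This is the shape of one hidden unit: for a fixed input, both the outer weight and the
  argument of the sigmoid are linear in the parameters.\<close>

lemma C11_mult_sigmoid:
  assumes p: "bounded_linear p" and q: "bounded_linear q"
  shows "C11 (\<lambda>a. p a * sigmoid (q a))"
proof -
  define s' where "s' z = sigmoid z * (1 - sigmoid z)" for z
  obtain P where P: "P > 0" "\<And>v. \<bar>p v\<bar> \<le> P * norm v"
    using bounded_linear.pos_bounded[OF p] by (metis mult.commute real_norm_def)
  obtain Q where Q: "Q > 0" "\<And>v. \<bar>q v\<bar> \<le> Q * norm v"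
    using bounded_linear.pos_bounded[OF q] by (metis mult.commute real_norm_def)
  have pd: "p (a - b) = p a - p b" and qd: "q (a - b) = q a - q b" for a b
    using p q by (auto simp: linear_diff bounded_linear.linear)
  have s'1: "\<bar>s' z\<bar> \<le> 1" for z
    unfolding s'_def by (rule abs_sigmoid_deriv_le)
  define f' where "f' a h = p a * (q h * s' (q a)) + p h * sigmoid (q a)" for a h
  have "((\<lambda>a. p a * sigmoid (q a)) has_derivative f' a) (at a)" for a
  proof -
    have "(sigmoid has_derivative (*) (s' (q a))) (at (q a))"
      using sigmoid_has_real_derivative[of "q a"] by (simp add: has_field_derivative_def s'_def)
    from has_derivative_compose[OF bounded_linear_imp_has_derivative[OF q] this]
    have "((\<lambda>a. sigmoid (q a)) has_derivative (\<lambda>h. s' (q a) * q h)) (at a)" .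
    from has_derivative_mult[OF bounded_linear_imp_has_derivative[OF p] this]
    show ?thesis by (simp add: f'_def[abs_def] mult.commute)
  qed
  moreover have "\<exists>K. \<forall>a\<in>cball 0 R. \<forall>b\<in>cball 0 R. \<forall>h.
      norm (f' a h - f' b h) \<le> K * norm (a - b) * norm h" for R
  proof -
    \<comment> \<open>\<open>2 * P * Q\<close> collects the first and third terms of the splitting
      below, \<open>P * Q * Q * R\<close> the middle one, where \<open>p b\<close> is bounded only
      on the ball.\<close>
    have "norm (f' a h - f' b h) \<le> (2 * P * Q + P * Q * Q * R) * norm (a - b) * norm h"
      if "a \<in> cball 0 R" "b \<in> cball 0 R" for a b h
    proof -
      have qab: "\<bar>q a - q b\<bar> \<le> Q * norm (a - b)"
        using Q(2)[of "a - b"] by (simp add: qd)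
      \<comment> \<open>The base point is exchanged one factor at a time: first in \<open>p\<close>,
        then in \<open>s'\<close>, finally in the sigmoid of the last term.\<close>
      have "f' a h - f' b h = p (a - b) * (q h * s' (q a)) + p b * (q h * (s' (q a) - s' (q b)))
          + p h * (sigmoid (q a) - sigmoid (q b))"
        by (simp add: f'_def pd algebra_simps)
      moreover have "\<bar>p (a - b) * (q h * s' (q a))\<bar> \<le> (P * norm (a - b)) * ((Q * norm h) * 1)"
        unfolding abs_mult using P Q s'1 by (intro mult_mono) auto
      moreover have "\<bar>p b * (q h * (s' (q a) - s' (q b)))\<bar>
          \<le> (P * R) * ((Q * norm h) * (Q * norm (a - b)))"
      proof -
        have "\<bar>p b\<bar> \<le> P * R"
          using P that(2) by (intro order_trans[OF P(2)] mult_left_mono) auto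
        moreover have "\<bar>s' (q a) - s' (q b)\<bar> \<le> Q * norm (a - b)"
          using sigmoid_deriv_lipschitz qab unfolding s'_def by (rule order_trans)
        ultimately show ?thesis
          unfolding abs_mult using P Q by (intro mult_mono) (auto intro: order_trans[OF abs_ge_zero])
      qed
      moreover have "\<bar>p h * (sigmoid (q a) - sigmoid (q b))\<bar>
          \<le> (P * norm h) * (Q * norm (a - b))"
      proof -
        have "\<bar>sigmoid (q a) - sigmoid (q b)\<bar> \<le> Q * norm (a - b)"
          using sigmoid_lipschitz qab by (rule order_trans)
        then show ?thesis
          unfolding abs_mult using P Q by (intro mult_mono) auto
      qed
      ultimately have "\<bar>f' a h - f' b h\<bar> \<le> (P * norm (a - b)) * ((Q * norm h) * 1)
          + (P * R) * ((Q * norm h) * (Q * norm (a - b))) + (P * norm h) * (Q * norm (a - b))"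
        by linarith
      then show ?thesis by (simp add: algebra_simps)
    qed
    then show ?thesis by blast
  qed
  ultimately show ?thesis
    unfolding C11_def by blast
qed

section \<open>Smoothness of the inner functions\<close>

lemma C11_network:
  fixes x :: "real ^ 'd::finite"
  shows "C11 (\<lambda>\<theta> :: ('d, 'q::finite) params. network \<theta> x)"
proof -
  have "bounded_linear (\<lambda>\<theta> :: ('d, 'q) params. par_w \<theta> i)"
    and "bounded_linear (par_w0 :: ('d, 'q) params \<Rightarrow> real)"
    and "bounded_linear (\<lambda>\<theta> :: ('d, 'q) params. par_v \<theta> i \<bullet> x + par_u \<theta> i)"
    for i
    unfolding par_w_def par_w0_def[abs_def] par_v_def par_u_def inner_vec_def
    by (auto intro!: bounded_linear_intros simp: bounded_linear_vec_nth)
  then show ?thesis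
    unfolding network_def
    by (intro C11_add C11_sum C11_mult_sigmoid C11_bounded_linear)
qed

lemma C11_inner_fun:
  fixes x :: "'m::finite \<Rightarrow> real ^ 'd::finite"
  shows "C11 (inner_fun kind x y :: ('d, 'q::finite) params \<Rightarrow> real ^ 'm)"
proof -
  have "C11 (\<lambda>\<theta> :: ('d, 'q) params. \<chi> i. network \<theta> (x i) + (- y i))"
    by (intro C11_vec C11_add C11_network C11_const)
  moreover have "C11 (\<lambda>\<theta> :: ('d, 'q) params. \<chi> i. y i * network \<theta> (x i))"
    by (intro C11_vec C11_bounded_linear_compose[OF bounded_linear_mult_right] C11_network)
  moreover have "inner_fun Quadratic x y = (\<lambda>\<theta> :: ('d, 'q) params. \<chi> i. network \<theta> (x i) + (- y i))"
    "inner_fun Absolute x y = (\<lambda>\<theta> :: ('d, 'q) params. \<chi> i. network \<theta> (x i) + (- y i))"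
    "inner_fun Hinge x y = (\<lambda>\<theta> :: ('d, 'q) params. \<chi> i. y i * network \<theta> (x i))"
    by auto
  ultimately show ?thesis
    by (cases kind) simp_all
qed

section \<open>Convexity and minimizers of the outer functions\<close>

lemma convex_on_coord_sum:
  fixes l :: "real \<Rightarrow> real"
  assumes "convex_on UNIV l"
  shows "convex_on UNIV (\<lambda>z :: real ^ 'm::finite. \<Sum>i\<in>UNIV. l (z $ i))"
proof (rule convex_onI)
  fix s :: real and a b :: "real ^ 'm"
  assume "0 < s" "s < 1"
  then have "l (((1 - s) *\<^sub>R a + s *\<^sub>R b) $ i) \<le> (1 - s) * l (a $ i) + s * l (b $ i)" for i
    using convex_onD[OF assms, of s "a $ i" "b $ i"] by simp
  then show "(\<Sum>i\<in>UNIV. l (((1 - s) *\<^sub>R a + s *\<^sub>R b) $ i))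
      \<le> (1 - s) * (\<Sum>i\<in>UNIV. l (a $ i)) + s * (\<Sum>i\<in>UNIV. l (b $ i))"
    by (simp add: sum_distrib_left sum.distrib[symmetric] sum_mono)
qed simp

lemma convex_on_outer_fun: "convex_on UNIV (outer_fun kind :: real ^ 'm::finite \<Rightarrow> real)"
proof -
  have sq: "convex_on UNIV (\<lambda>v::real. v\<^sup>2)"
    by (rule convex_on_realI[where f' = "\<lambda>v. 2 * v"]) (auto intro!: derivative_eq_intros)
  have abs: "convex_on UNIV (\<lambda>v::real. \<bar>v\<bar>)"
    using convex_on_dist[of UNIV "0::real"] by simp
  have hinge: "convex_on UNIV (\<lambda>v::real. max (1 - v) 0)"
  proof (rule convex_onI)
    fix s a b :: real
    assume s: "0 < s" "s < 1"
    then have "(1 - s) * (1 - a) \<le> (1 - s) * max (1 - a) 0" "s * (1 - b) \<le> s * max (1 - b) 0"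
      by (auto intro: mult_left_mono)
    moreover have "0 \<le> (1 - s) * max (1 - a) 0" "0 \<le> s * max (1 - b) 0"
      using s by auto
    moreover have "1 - ((1 - s) * a + s * b) = (1 - s) * (1 - a) + s * (1 - b)"
      by (simp add: algebra_simps)
    ultimately show "max (1 - ((1 - s) *\<^sub>R a + s *\<^sub>R b)) 0
        \<le> (1 - s) * max (1 - a) 0 + s * max (1 - b) 0"
      by simp
  qed simp
  note convex_sum = convex_on_cdiv[OF of_nat_0_le_iff convex_on_coord_sum]
  show ?thesis
  proof (cases kind)
    case Quadratic
    have "outer_fun Quadratic = (\<lambda>z :: real ^ 'm. (\<Sum>i\<in>UNIV. (z $ i)\<^sup>2) / real CARD('m))"
      by auto
    then show ?thesis using convex_sum[OF sq] Quadratic by metis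
  next
    case Absolute
    have "outer_fun Absolute = (\<lambda>z :: real ^ 'm. (\<Sum>i\<in>UNIV. \<bar>z $ i\<bar>) / real CARD('m))"
      by auto
    then show ?thesis using convex_sum[OF abs] Absolute by metis
  next
    case Hinge
    have "outer_fun Hinge = (\<lambda>z :: real ^ 'm. (\<Sum>i\<in>UNIV. max (1 - z $ i) 0) / real CARD('m))"
      by auto
    then show ?thesis using convex_sum[OF hinge] Hinge by metis
  qed
qed

lemma argmin_set_outer_fun_nonempty: "argmin_set (outer_fun kind :: real ^ 'm::finite \<Rightarrow> real) \<noteq> {}"
proof -
  \<comment> \<open>A zero of the loss; for the hinge loss, \<open>1\<close> is the all-ones
    vector.\<close>
  define z0 :: "real ^ 'm" where "z0 = (if kind = Hinge then 1 else 0)"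
  have "0 \<le> outer_fun kind z" for z :: "real ^ 'm"
    by (cases kind) (auto intro!: divide_nonneg_nonneg sum_nonneg)
  moreover have "outer_fun kind z0 = 0"
    unfolding z0_def by (cases kind) auto
  ultimately have "z0 \<in> argmin_set (outer_fun kind)"
    by (simp add: argmin_set_def is_arg_min_def not_less)
  then show ?thesis by blast
qed

section \<open>Lipschitz bounds for convex functions\<close>

text \<open>Boundedness on the ball of radius \<open>R + 1\<close> leaves room to prolong each
  segment by one unit beyond its end; convexity then controls the slope on the segment by the
  oscillation of \<open>L\<close>, at most \<open>2 * B\<close>.\<close>

lemma convex_lipschitz_on_cball:
  fixes L :: "'a::euclidean_space \<Rightarrow> real"
  assumes "convex_on UNIV L"
  obtains \<Lambda> where "\<Lambda> \<ge> 0"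
    "\<And>a b. \<lbrakk>norm a \<le> R; norm b \<le> R\<rbrakk> \<Longrightarrow> \<bar>L a - L b\<bar> \<le> \<Lambda> * norm (a - b)"
proof -
  have "continuous_on (cball 0 (R + 1)) L"
    using convex_on_continuous[OF open_UNIV assms] continuous_on_subset by blast
  then have "bounded (L ` cball 0 (R + 1))"
    by (intro compact_imp_bounded compact_continuous_image) auto
  then obtain B where B0: "B > 0" and B: "\<And>a. norm a \<le> R + 1 \<Longrightarrow> \<bar>L a\<bar> \<le> B"
    by (auto simp: bounded_pos)
  have one_sided: "L b - L a \<le> 2 * B * norm (a - b)" if "norm a \<le> R" "norm b \<le> R" for a b
  proof (cases "a = b")
    case False
    define d where "d = norm (b - a)"
    \<comment> \<open>The point one unit beyond \<open>b\<close> on the ray from \<open>a\<close>,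
      so that \<open>b\<close> sits at the fraction \<open>d / (1 + d)\<close> of the segment from
      \<open>a\<close> to \<open>z\<close>.\<close>
    define z where "z = b + (1 / d) *\<^sub>R (b - a)"
    have "d > 0" using False by (simp add: d_def)
    have "norm z \<le> norm b + 1"
      unfolding z_def using \<open>d > 0\<close> by (intro order_trans[OF norm_triangle_ineq]) (simp add: d_def)
    then have z: "\<bar>L z\<bar> \<le> B" using B that by simp
    have "b = (1 - d / (1 + d)) *\<^sub>R a + (d / (1 + d)) *\<^sub>R z"
    proof -
      have "(1 + d) *\<^sub>R b = a + d *\<^sub>R z"
        using \<open>d > 0\<close> by (simp add: z_def algebra_simps)
      then have "b = (1 / (1 + d)) *\<^sub>R (a + d *\<^sub>R z)"
        using \<open>d > 0\<close> by (metis add_pos_pos less_irrefl scaleR_scaleR nonzero_divide_eq_eq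
            scaleR_one zero_less_one)
      moreover have "1 - d / (1 + d) = 1 / (1 + d)"
        using \<open>d > 0\<close> by (simp add: field_simps)
      ultimately show ?thesis
        by (simp add: scaleR_add_right)
    qed
    moreover have "L ((1 - d / (1 + d)) *\<^sub>R a + (d / (1 + d)) *\<^sub>R z)
        \<le> (1 - d / (1 + d)) * L a + (d / (1 + d)) * L z"
      using \<open>d > 0\<close> by (intro convex_onD[OF assms]) (auto simp: field_simps)
    ultimately have "L b \<le> (1 - d / (1 + d)) * L a + (d / (1 + d)) * L z"
      by simp
    then have "L b - L a \<le> (d / (1 + d)) * (L z - L a)"
      unfolding left_diff_distrib right_diff_distrib by linarith
    also have "\<dots> \<le> (d / (1 + d)) * (2 * B)"
      using z B[of a] that \<open>d > 0\<close> by (intro mult_left_mono) auto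
    also have "\<dots> \<le> d * (2 * B)"
      using \<open>d > 0\<close> B0 by (intro mult_right_mono) (auto simp: field_simps)
    finally show ?thesis by (simp add: d_def norm_minus_commute mult_ac)
  qed simp
  show thesis
  proof
    show "0 \<le> 2 * B" using B0 by simp
    show "\<bar>L a - L b\<bar> \<le> 2 * B * norm (a - b)" if "norm a \<le> R" "norm b \<le> R" for a b
      using one_sided[of a b] one_sided[of b a] that by (simp add: norm_minus_commute abs_le_iff)
  qed
qed

section \<open>The line search and stationarity of cluster points\<close>

locale composite_problem =
  fixes L :: "real ^ 'm \<Rightarrow> real" and F :: "real ^ 'n \<Rightarrow> real ^ 'm" and t c \<tau> :: real
  assumes convex_L: "convex_on UNIV L" and C11_F: "C11 F"
    and argmin_nonempty: "argmin_set L \<noteq> {}"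
    and t_pos: "t > 0" and c_bounds: "0 < c" "c < 1" and \<tau>_bounds: "0 < \<tau>" "\<tau> < 1"
begin

abbreviation J :: "real ^ 'n \<Rightarrow> real ^ 'n \<Rightarrow> real ^ 'm" where
  "J a h \<equiv> jacobian F (at a) *v h"

abbreviation Lmin :: real where
  "Lmin \<equiv> (INF z. L z)"

abbreviation glpa_direction :: "real ^ 'n \<Rightarrow> real ^ 'n \<Rightarrow> bool" where
  "glpa_direction a d \<equiv> is_arg_min (prox_model L F t a) (\<lambda>_. True) d"

text \<open>One iteration as a relation between points, free of the index \<open>k\<close>, so that
  estimates can be uniform in the starting point. Stopping appears as \<open>a' = a\<close>.\<close>

definition glpa_next :: "real ^ 'n \<Rightarrow> real ^ 'n \<Rightarrow> bool" where
  "glpa_next a a' \<longleftrightarrow> (\<exists>d. glpa_direction a d \<and>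
     (if d = 0 then a' = a
      else \<exists>j. line_search_ok L F t c a d (\<tau> ^ j) \<and>
               (\<forall>i<j. \<not> line_search_ok L F t c a d (\<tau> ^ i)) \<and> a' = a + \<tau> ^ j *\<^sub>R d))"

section \<open>The minimum value and the set of minimizers of \<open>L\<close>\<close>

lemma Lmin_le: "Lmin \<le> L z" and L_eq_Lmin_iff: "L z = Lmin \<longleftrightarrow> z \<in> argmin_set L"
proof -
  obtain z0 where "\<And>w. L z0 \<le> L w"
    using argmin_nonempty by (auto simp: argmin_set_def is_arg_min_def not_less)
  \<comment> \<open>The infimum is attained at \<open>z0\<close>, so \<open>INF\<close> has its
    intended value; on the reals it is meaningful only for sets that are bounded below.\<close>
  moreover from this have "Lmin = L z0"
    by (intro cInf_eq_minimum) auto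
  ultimately show "Lmin \<le> L z" "L z = Lmin \<longleftrightarrow> z \<in> argmin_set L"
    by (auto simp: argmin_set_def is_arg_min_def not_less intro: antisym)
qed

lemma closed_argmin: "closed (argmin_set L)" and convex_argmin: "convex (argmin_set L)"
proof -
  \<comment> \<open>As a sublevel set of a continuous convex function, \<open>argmin_set L\<close>
    inherits both properties.\<close>
  have eq: "argmin_set L = {z. L z \<le> Lmin}"
    using L_eq_Lmin_iff Lmin_le by (metis (mono_tags) Collect_cong Collect_mem_eq antisym order_refl)
  show "closed (argmin_set L)"
    unfolding eq using convex_on_continuous[OF open_UNIV convex_L]
    by (intro closed_Collect_le) auto
  show "convex (argmin_set L)"
    unfolding eq
  proof (rule convexI)
    fix z w and u v :: real
    assume "z \<in> {z. L z \<le> Lmin}" "w \<in> {z. L z \<le> Lmin}" and uv: "0 \<le> u" "0 \<le> v" "u + v = 1"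
    then have "u * L z + v * L w \<le> u * Lmin + v * Lmin"
      by (intro add_mono mult_left_mono) auto
    also have "\<dots> = Lmin"
      using uv by (simp add: distrib_right[symmetric])
    finally have "u * L z + v * L w \<le> Lmin" .
    moreover have "L (u *\<^sub>R z + v *\<^sub>R w) \<le> u * L z + v * L w"
      using convex_L uv unfolding convex_on_def by blast
    ultimately show "u *\<^sub>R z + v *\<^sub>R w \<in> {z. L z \<le> Lmin}"
      by simp
  qed
qed

section \<open>Local estimates for \<open>F\<close> and its linearization\<close>

lemma J_add: "J a (g + h) = J a g + J a h"
  and J_scaleR: "J a (s *\<^sub>R h) = s *\<^sub>R J a h" and J_zero: "J a 0 = 0"
  by (simp_all add: matrix_vector_right_distrib
      matrix_vector_mult_scaleR)

lemma F_has_derivative: "(F has_derivative J a) (at a)"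
  using C11_F jacobian_works unfolding C11_def differentiable_def by blast

lemma J_lipschitz_on_cball:
  obtains K where "K > 0"
    "\<And>a b h. \<lbrakk>norm a \<le> R; norm b \<le> R\<rbrakk> \<Longrightarrow> norm (J a h - J b h) \<le> K * norm (a - b) * norm h"
proof -
  obtain F' where F': "\<And>a. (F has_derivative F' a) (at a)"
    and "\<exists>K. \<forall>a\<in>cball 0 R. \<forall>b\<in>cball 0 R. \<forall>h. norm (F' a h - F' b h) \<le> K * norm (a - b) * norm h"
    using C11_F unfolding C11_def by blast
  \<comment> \<open>Uniqueness of the derivative transfers the bound from the anonymous
    \<open>F'\<close> to the Jacobian.\<close>
  moreover have "F' a = J a" for a
    using F' F_has_derivative has_derivative_unique by blast
  ultimately obtain K where K: "\<And>a b h. \<lbrakk>norm a \<le> R; norm b \<le> R\<rbrakk> \<Longrightarrow>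
      norm (J a h - J b h) \<le> K * norm (a - b) * norm h"
    unfolding mem_cball_0[symmetric] by metis
  \<comment> \<open>\<open>\<bar>K\<bar> + 1\<close> is positive whatever the sign of
    \<open>K\<close>, which \<open>C11\<close> leaves open.\<close>
  have "norm (J a h - J b h) \<le> (\<bar>K\<bar> + 1) * norm (a - b) * norm h"
    if "norm a \<le> R" "norm b \<le> R" for a b h
    using K[OF that, of h] by (rule order_trans) (intro mult_right_mono, auto)
  then show thesis
    using that[of "\<bar>K\<bar> + 1"] by simp
qed

lemma J_bounded_on_cball:
  obtains K where "K > 0" "\<And>a h. norm a \<le> R \<Longrightarrow> norm (J a h) \<le> K * norm h"
proof -
  obtain K1 where "K1 > 0" and K1: "\<And>a b h. \<lbrakk>norm a \<le> R; norm b \<le> R\<rbrakk> \<Longrightarrow>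
      norm (J a h - J b h) \<le> K1 * norm (a - b) * norm h"
    using J_lipschitz_on_cball[where R = R] by blast
  obtain K0 where "K0 > 0" and K0: "\<And>h. norm (J 0 h) \<le> K0 * norm h"
    using bounded_linear.pos_bounded[OF has_derivative_bounded_linear[OF F_has_derivative]]
    by (metis mult.commute)
  \<comment> \<open>Comparison with the Jacobian at \<open>0\<close>. \<open>\<bar>R\<bar>\<close>
    keeps the constant positive for negative \<open>R\<close>, where the ball is empty.\<close>
  have "norm (J a h) \<le> (K0 + K1 * \<bar>R\<bar>) * norm h" if "norm a \<le> R" for a h
  proof -
    have "norm (0 :: real ^ 'n) \<le> R"
      using that norm_ge_zero[of a] by (simp del: norm_ge_zero)
    then have "norm (J a h - J 0 h) \<le> K1 * norm a * norm h"
      using K1[OF that, of 0 h] by simp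
    also have "\<dots> \<le> K1 * \<bar>R\<bar> * norm h"
      using that \<open>K1 > 0\<close> by (intro mult_right_mono mult_left_mono) auto
    finally have "norm (J a h) \<le> K1 * \<bar>R\<bar> * norm h + K0 * norm h"
      using K0[of h] norm_triangle_sub[of "J a h" "J 0 h"] by linarith
    then show ?thesis by (simp add: algebra_simps)
  qed
  moreover have "K0 + K1 * \<bar>R\<bar> > 0"
    using \<open>K0 > 0\<close> \<open>K1 > 0\<close> by (simp add: add_pos_nonneg)
  ultimately show thesis by (rule that[rotated])
qed

lemma F_lipschitz_on_cball:
  obtains K where "K > 0"
    "\<And>a b. \<lbrakk>norm a \<le> R; norm b \<le> R\<rbrakk> \<Longrightarrow> norm (F a - F b) \<le> K * norm (a - b)"
proof -
  obtain K where "K > 0" and K: "\<And>a h. norm a \<le> R \<Longrightarrow> norm (J a h) \<le> K * norm h"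
    using J_bounded_on_cball[where R = R] by blast
  have "norm (F a - F b) \<le> K * norm (a - b)" if "norm a \<le> R" "norm b \<le> R" for a b
  proof (rule differentiable_bound[where S = "cball 0 R" and f' = J])
    show "(F has_derivative J z) (at z within cball 0 R)" for z
      using F_has_derivative by (rule has_derivative_at_withinI)
    show "onorm (J z) \<le> K" if "z \<in> cball 0 R" for z
      using K[of z] that by (intro onorm_le) auto
  qed (use that in auto)
  with \<open>K > 0\<close> show thesis by (rule that)
qed

text \<open>Mean value inequality for \<open>F z - J a z\<close> on the segment from
  \<open>a\<close> to \<open>a + h\<close>: its derivative \<open>J z - J a\<close> has norm at most
  \<open>K * norm h\<close> there.\<close>

lemma F_quadratic_error_on_cball:
  obtains K where "K > 0"
    "\<And>a h. \<lbrakk>norm a \<le> R; norm (a + h) \<le> R\<rbrakk> \<Longrightarrow> norm (F (a + h) - (F a + J a h)) \<le> K * (norm h)\<^sup>2"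
proof -
  obtain K where "K > 0" and K: "\<And>a b h. \<lbrakk>norm a \<le> R; norm b \<le> R\<rbrakk> \<Longrightarrow>
      norm (J a h - J b h) \<le> K * norm (a - b) * norm h"
    using J_lipschitz_on_cball[where R = R] by blast
  have "norm (F (a + h) - (F a + J a h)) \<le> K * (norm h)\<^sup>2"
    if a: "norm a \<le> R" and ah: "norm (a + h) \<le> R" for a h
  proof -
    define S where "S = closed_segment a (a + h)"
    have S: "norm z \<le> R" "norm (z - a) \<le> norm h" if "z \<in> S" for z
    proof -
      have "S \<subseteq> cball 0 R"
        unfolding S_def using a ah by (intro closed_segment_subset) auto
      then show "norm z \<le> R" using that by auto
      show "norm (z - a) \<le> norm h"
        using segment_bound(1)[OF that[unfolded S_def]] by simp
    qed
    have "norm ((\<lambda>z. F z - J a z) (a + h) - (\<lambda>z. F z - J a z) a) \<le> (K * norm h) * norm ((a + h) - a)"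
    proof (rule differentiable_bound[where S = S and f' = "\<lambda>z v. J z v - J a v"])
      show "((\<lambda>z. F z - J a z) has_derivative (\<lambda>v. J z v - J a v)) (at z within S)" for z
        by (intro has_derivative_diff has_derivative_at_withinI[OF F_has_derivative]
            bounded_linear_imp_has_derivative has_derivative_bounded_linear[OF F_has_derivative])
      show "onorm (\<lambda>v. J z v - J a v) \<le> K * norm h" if z: "z \<in> S" for z
      proof (rule onorm_le)
        fix v
        have "norm (J z v - J a v) \<le> K * norm (z - a) * norm v"
          using S(1)[OF z] a by (rule K)
        also have "\<dots> \<le> K * norm h * norm v"
          using S(2)[OF z] \<open>K > 0\<close> by (intro mult_right_mono mult_left_mono) auto
        finally show "norm (J z v - J a v) \<le> K * norm h * norm v" .
      qed
    qed (auto simp: S_def)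
    then show ?thesis by (simp add: J_add power2_eq_square algebra_simps)
  qed
  with \<open>K > 0\<close> show thesis by (rule that)
qed

text \<open>The quadratic error of \<open>F\<close> passes through \<open>L\<close>, which is
  Lipschitz on bounded sets. The radius \<open>2 * R\<close> accommodates
  \<open>a + h\<close>.\<close>

lemma linearization_error:
  obtains Q where "Q > 0"
    "\<And>a h. \<lbrakk>norm a \<le> R; norm h \<le> R\<rbrakk> \<Longrightarrow> \<bar>L (F (a + h)) - L (F a + J a h)\<bar> \<le> Q * (norm h)\<^sup>2"
proof -
  obtain KJ where "KJ > 0" and KJ: "\<And>a h. norm a \<le> 2 * R \<Longrightarrow> norm (J a h) \<le> KJ * norm h"
    using J_bounded_on_cball[where R = "2 * R"] by blast
  obtain KF where "KF > 0"
    and KF: "\<And>a b. \<lbrakk>norm a \<le> 2 * R; norm b \<le> 2 * R\<rbrakk> \<Longrightarrow> norm (F a - F b) \<le> KF * norm (a - b)"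
    using F_lipschitz_on_cball[where R = "2 * R"] by blast
  obtain K where "K > 0" and quad: "\<And>a h. \<lbrakk>norm a \<le> 2 * R; norm (a + h) \<le> 2 * R\<rbrakk> \<Longrightarrow>
      norm (F (a + h) - (F a + J a h)) \<le> K * (norm h)\<^sup>2"
    using F_quadratic_error_on_cball[where R = "2 * R"] by blast
  \<comment> \<open>Bounds both \<open>F (a + h)\<close> and \<open>F a + J a h\<close>: the first
    two summands bound \<open>F\<close> on the ball of radius \<open>2 * R\<close>, the last one
    bounds \<open>J a h\<close>.\<close>
  define B where "B = norm (F 0) + KF * (2 * R) + KJ * R"
  obtain \<Lambda> where "\<Lambda> \<ge> 0"
    and \<Lambda>: "\<And>z w. \<lbrakk>norm z \<le> B; norm w \<le> B\<rbrakk> \<Longrightarrow> \<bar>L z - L w\<bar> \<le> \<Lambda> * norm (z - w)"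
    using convex_lipschitz_on_cball[OF convex_L, where R = B] by blast
  have F_bound: "norm (F b) \<le> norm (F 0) + KF * (2 * R)" if "norm b \<le> 2 * R" for b
  proof -
    have "0 \<le> 2 * R" using that norm_ge_zero[of b] by linarith
    then have "norm (F b - F 0) \<le> KF * norm b"
      using KF[of b 0] that by simp
    also have "\<dots> \<le> KF * (2 * R)"
      using that \<open>KF > 0\<close> by (intro mult_left_mono) auto
    finally show ?thesis using norm_triangle_sub[of "F b" "F 0"] by linarith
  qed
  \<comment> \<open>The summand \<open>1\<close> makes the constant positive also for
    \<open>\<Lambda> = 0\<close>.\<close>
  have "\<bar>L (F (a + h)) - L (F a + J a h)\<bar> \<le> (\<Lambda> * K + 1) * (norm h)\<^sup>2"
    if a: "norm a \<le> R" and h: "norm h \<le> R" for a h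
  proof -
    have R: "0 \<le> R" using a norm_ge_zero[of a] by linarith
    have 2: "norm a \<le> 2 * R" "norm (a + h) \<le> 2 * R"
      using a h R norm_triangle_ineq[of a h] by linarith+
    have "norm (J a h) \<le> KJ * R"
      using KJ[OF 2(1), of h] mult_left_mono[OF h, of KJ] \<open>KJ > 0\<close> by linarith
    moreover have "0 \<le> KJ * R" using \<open>KJ > 0\<close> R by simp
    ultimately have "\<bar>L (F (a + h)) - L (F a + J a h)\<bar> \<le> \<Lambda> * norm (F (a + h) - (F a + J a h))"
      using F_bound[OF 2(1)] F_bound[OF 2(2)] norm_triangle_ineq[of "F a" "J a h"]
      unfolding B_def by (intro \<Lambda>[unfolded B_def]) linarith+
    also have "\<dots> \<le> \<Lambda> * (K * (norm h)\<^sup>2)"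
      using quad[OF 2] \<open>\<Lambda> \<ge> 0\<close> by (intro mult_left_mono)
    also have "\<dots> \<le> (\<Lambda> * K + 1) * (norm h)\<^sup>2"
      by (simp add: algebra_simps)
    finally show ?thesis .
  qed
  moreover have "\<Lambda> * K + 1 > 0"
    using \<open>\<Lambda> \<ge> 0\<close> \<open>K > 0\<close> by (simp add: add_nonneg_pos)
  ultimately show thesis using that by blast
qed

section \<open>Continuity and elementary bounds for the proximal model\<close>

lemma isCont_L: "isCont L z"
  using convex_on_continuous[OF open_UNIV convex_L] by (simp add: continuous_on_eq_continuous_at)

lemma isCont_F: "isCont F a"
  using F_has_derivative by (rule has_derivative_continuous)

lemma isCont_J: "isCont (\<lambda>a. J a h) a"
proof -
  obtain K where "K > 0" and K: "\<And>b b' g. \<lbrakk>norm b \<le> norm a + 1; norm b' \<le> norm a + 1\<rbrakk> \<Longrightarrow>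
      norm (J b g - J b' g) \<le> K * norm (b - b') * norm g"
    using J_lipschitz_on_cball[where R = "norm a + 1"] by blast
  have "((\<lambda>b. J b h - J a h) \<longlongrightarrow> 0) (at a)"
  proof (rule Lim_null_comparison)
    have "\<forall>\<^sub>F b in at a. dist b a < 1"
      by (simp add: eventually_at_ball' eventually_at) (metis zero_less_one)
    then show "\<forall>\<^sub>F b in at a. norm (J b h - J a h) \<le> K * norm (b - a) * norm h"
    proof eventually_elim
      case (elim b)
      then show ?case
        using norm_triangle_sub[of b a] by (intro K) (auto simp: dist_norm)
    qed
    show "((\<lambda>b. K * norm (b - a) * norm h) \<longlongrightarrow> 0) (at a)"
      by (auto intro!: tendsto_eq_intros)
  qed
  then show ?thesis
    unfolding isCont_def using Lim_null by blast
qed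

lemma isCont_prox_model: "isCont (\<lambda>a. prox_model L F t a d) a"
  unfolding prox_model_def
  by (intro continuous_intros isCont_o2[OF _ isCont_L] isCont_F isCont_J)

lemma glpa_directionD: "glpa_direction a d \<Longrightarrow> prox_model L F t a d \<le> prox_model L F t a d'"
  by (auto simp: is_arg_min_def not_less)

lemma prox_model_zero: "prox_model L F t a 0 = L (F a)"
  by (simp add: prox_model_def)

text \<open>The linearized value is at least \<open>Lmin\<close>, so the excess of the model over
  \<open>Lmin\<close> dominates its quadratic term. This turns bounds on the model into bounds on
  the step length.\<close>

lemma norm_le_prox_model: "(norm d)\<^sup>2 \<le> 2 * t * (prox_model L F t a d - Lmin)"
  using Lmin_le[of "F a + J a d"] t_pos by (simp add: prox_model_def field_simps)

text \<open>By convexity, the linearized decrease along a step \<open>\<eta>\<close> is at least \<open>\<eta>\<close> times the full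
  model decrease plus \<open>\<eta> (norm d)\<^sup>2 / (2 t)\<close>; for small \<open>\<eta>\<close> this surplus pays for the
  linearization error \<open>Q \<eta>\<^sup>2 (norm d)\<^sup>2\<close>.\<close>

lemma line_search_accepts_small_steps:
  obtains \<eta>\<^sub>0 where "0 < \<eta>\<^sub>0" "\<eta>\<^sub>0 \<le> 1"
    "\<And>a d \<eta>. \<lbrakk>norm a \<le> R; norm d \<le> R; glpa_direction a d; 0 < \<eta>; \<eta> \<le> \<eta>\<^sub>0\<rbrakk> \<Longrightarrow>
       line_search_ok L F t c a d \<eta>"
proof -
  obtain Q where "Q > 0" and Q: "\<And>a h. \<lbrakk>norm a \<le> R; norm h \<le> R\<rbrakk> \<Longrightarrow>
      \<bar>L (F (a + h)) - L (F a + J a h)\<bar> \<le> Q * (norm h)\<^sup>2"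
    using linearization_error[where R = R] by blast
  \<comment> \<open>Below \<open>1 / (2 * t * Q)\<close> the linearization error, quadratic in
    \<open>\<eta>\<close>, stays under the surplus, which is linear in \<open>\<eta>\<close>; the
    cap \<open>1\<close> makes convexity applicable.\<close>
  define \<eta>\<^sub>0 where "\<eta>\<^sub>0 = min 1 (1 / (2 * t * Q))"
  have "line_search_ok L F t c a d \<eta>"
    if "norm a \<le> R" "norm d \<le> R" and d: "glpa_direction a d" and \<eta>: "0 < \<eta>" "\<eta> \<le> \<eta>\<^sub>0" for a d \<eta>
  proof -
    let ?P = "prox_model L F t a d"
    have "\<eta> \<le> 1" "\<eta> * (2 * t * Q) \<le> 1"
      using \<eta> t_pos \<open>Q > 0\<close> by (auto simp: \<eta>\<^sub>0_def field_simps)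
    then have "\<eta> * norm d \<le> 1 * norm d"
      by (intro mult_right_mono) auto
    then have "norm (\<eta> *\<^sub>R d) \<le> R"
      using that by simp
    then have "L (F (a + \<eta> *\<^sub>R d)) \<le> L (F a + J a (\<eta> *\<^sub>R d)) + Q * (norm (\<eta> *\<^sub>R d))\<^sup>2"
      using Q[of a "\<eta> *\<^sub>R d"] that by auto
    also have "L (F a + J a (\<eta> *\<^sub>R d)) = L ((1 - \<eta>) *\<^sub>R F a + \<eta> *\<^sub>R (F a + J a d))"
      by (simp add: J_scaleR algebra_simps)
    also have "\<dots> \<le> (1 - \<eta>) * L (F a) + \<eta> * L (F a + J a d)"
      using \<eta> \<open>\<eta> \<le> 1\<close> by (intro convex_onD[OF convex_L]) auto
    also have "\<dots> = L (F a) + \<eta> * (?P - L (F a)) - \<eta> * ((norm d)\<^sup>2 / (2 * t))"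
      by (simp add: prox_model_def algebra_simps)
    also have "Q * (norm (\<eta> *\<^sub>R d))\<^sup>2 \<le> \<eta> * ((norm d)\<^sup>2 / (2 * t))"
    proof -
      have "Q * (norm (\<eta> *\<^sub>R d))\<^sup>2 = \<eta> * ((\<eta> * (2 * t * Q)) * (norm d)\<^sup>2 / (2 * t))"
        using \<eta> t_pos by (simp add: power_mult_distrib power2_eq_square field_simps)
      also have "\<dots> \<le> \<eta> * (1 * (norm d)\<^sup>2 / (2 * t))"
        using \<eta> t_pos \<open>\<eta> * (2 * t * Q) \<le> 1\<close>
        by (intro mult_left_mono divide_right_mono mult_right_mono) auto
      finally show ?thesis by simp
    qed
    finally have "L (F (a + \<eta> *\<^sub>R d)) - L (F a) \<le> \<eta> * (?P - L (F a))"
      by simp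
    \<comment> \<open>The model decrease is nonpositive because direction \<open>0\<close> competes,
      so multiplying it by \<open>c < 1\<close> only weakens the bound.\<close>
    also have "\<dots> \<le> c * (\<eta> * (?P - L (F a)))"
    proof -
      have "\<eta> * (?P - L (F a)) \<le> 0"
        using \<eta> glpa_directionD[OF d, of 0] by (simp add: prox_model_zero mult_le_0_iff)
      then show ?thesis
        using c_bounds mult_right_mono_neg[of c 1 "\<eta> * (?P - L (F a))"] by simp
    qed
    finally show ?thesis
      by (simp add: line_search_ok_def mult.assoc)
  qed
  moreover have "0 < \<eta>\<^sub>0" "\<eta>\<^sub>0 \<le> 1"
    using t_pos \<open>Q > 0\<close> by (auto simp: \<eta>\<^sub>0_def)
  ultimately show thesis using that by blast
qed

section \<open>Decrease of the objective along a run\<close>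

lemma glpa_next_nonincreasing:
  assumes "glpa_next a a'"
  shows "L (F a') \<le> L (F a)"
proof -
  obtain d where d: "glpa_direction a d"
    and "a' = a \<or> (\<exists>j. line_search_ok L F t c a d (\<tau> ^ j) \<and> a' = a + \<tau> ^ j *\<^sub>R d)"
    using assms unfolding glpa_next_def by metis
  \<comment> \<open>Direction \<open>0\<close> competes in the model, so the right-hand side of the
    line search condition is nonpositive.\<close>
  moreover have "c * \<tau> ^ j * (prox_model L F t a d - L (F a)) \<le> 0" for j
    using glpa_directionD[OF d, of 0] c_bounds \<tau>_bounds
    by (intro mult_nonneg_nonpos) (auto simp: prox_model_zero)
  ultimately show ?thesis
    unfolding line_search_ok_def by (smt (verit))
qed

text \<open>Backtracking from a bounded set never goes below the step
  \<open>\<tau> * \<eta>\<^sub>0\<close>, and the minimal model value is at most the one at any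
  \<open>d'\<close>. The free competitor \<open>d'\<close> permits a limit in \<open>a\<close>
  without any convergence of the search directions.\<close>

lemma glpa_next_sufficient_decrease:
  obtains \<delta> where "\<delta> > 0"
    "\<And>a a' d'. \<lbrakk>norm a \<le> R; glpa_next a a'\<rbrakk> \<Longrightarrow>
       L (F a') \<le> L (F a) + \<delta> * (prox_model L F t a d' - L (F a))"
proof -
  have "continuous_on (cball 0 R) (\<lambda>a. L (F a))"
    by (intro continuous_at_imp_continuous_on ballI isCont_o2[OF isCont_F isCont_L])
  then have "bounded ((\<lambda>a. L (F a)) ` cball 0 R)"
    by (intro compact_imp_bounded compact_continuous_image) auto
  then obtain B where B: "\<And>a. norm a \<le> R \<Longrightarrow> \<bar>L (F a)\<bar> \<le> B"
    unfolding bounded_pos by (metis imageI mem_cball_0 real_norm_def)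
  \<comment> \<open>Bounds all search directions from the ball: the model value is at most
    \<open>B\<close>, and \<open>norm_le_prox_model\<close> gives the square root.\<close>
  define R' where "R' = max R (sqrt (2 * t * (B - Lmin)))"
  obtain \<eta>\<^sub>0 where "0 < \<eta>\<^sub>0" "\<eta>\<^sub>0 \<le> 1" and ls:
    "\<And>a d \<eta>. \<lbrakk>norm a \<le> R'; norm d \<le> R'; glpa_direction a d; 0 < \<eta>; \<eta> \<le> \<eta>\<^sub>0\<rbrakk> \<Longrightarrow>
       line_search_ok L F t c a d \<eta>"
    using line_search_accepts_small_steps[where R = R'] by blast
  have "L (F a') \<le> L (F a) + c * (\<tau> * \<eta>\<^sub>0) * (prox_model L F t a d' - L (F a))"
    if a: "norm a \<le> R" and "glpa_next a a'" for a a' d'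
  proof -
    obtain d where d: "glpa_direction a d" and a': "if d = 0 then a' = a else
        \<exists>j. line_search_ok L F t c a d (\<tau> ^ j) \<and>
          (\<forall>i<j. \<not> line_search_ok L F t c a d (\<tau> ^ i)) \<and> a' = a + \<tau> ^ j *\<^sub>R d"
      using \<open>glpa_next a a'\<close> unfolding glpa_next_def by metis
    let ?g = "prox_model L F t a d - L (F a)"
    have "?g \<le> 0"
      using glpa_directionD[OF d, of 0] by (simp add: prox_model_zero)
    have "L (F a') \<le> L (F a) + c * (\<tau> * \<eta>\<^sub>0) * ?g"
    proof (cases "d = 0")
      case True
      then show ?thesis using a' by (simp add: prox_model_zero)
    next
      case False
      then obtain j where ok: "line_search_ok L F t c a d (\<tau> ^ j)"
        and first: "\<And>i. i < j \<Longrightarrow> \<not> line_search_ok L F t c a d (\<tau> ^ i)"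
        and a'_eq: "a' = a + \<tau> ^ j *\<^sub>R d"
        using a' by auto
      have "(norm d)\<^sup>2 \<le> 2 * t * (prox_model L F t a d - Lmin)"
        by (rule norm_le_prox_model)
      also have "\<dots> \<le> 2 * t * (B - Lmin)"
        using \<open>?g \<le> 0\<close> B[OF a] t_pos by (intro mult_left_mono) auto
      finally have "norm d \<le> R'"
        unfolding R'_def by (simp add: real_le_rsqrt le_max_iff_disj)
      have "norm a \<le> R'"
        using a by (simp add: R'_def)
      \<comment> \<open>Either the unit step is accepted, or the preceding candidate
        \<open>\<tau> ^ (j - 1)\<close> was rejected and therefore exceeds
        \<open>\<eta>\<^sub>0\<close>.\<close>
      have "\<tau> * \<eta>\<^sub>0 \<le> \<tau> ^ j"
      proof (cases j)
        case 0
        then show ?thesis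
          using \<tau>_bounds \<open>0 < \<eta>\<^sub>0\<close> \<open>\<eta>\<^sub>0 \<le> 1\<close> by (simp add: mult_le_one)
      next
        case (Suc i)
        then have "\<not> \<tau> ^ i \<le> \<eta>\<^sub>0"
          using ls[OF \<open>norm a \<le> R'\<close> \<open>norm d \<le> R'\<close> d, of "\<tau> ^ i"] first[of i] \<tau>_bounds by auto
        then show ?thesis using Suc \<tau>_bounds by simp
      qed
      then have "c * \<tau> ^ j * ?g \<le> c * (\<tau> * \<eta>\<^sub>0) * ?g"
        using c_bounds \<open>?g \<le> 0\<close> by (intro mult_right_mono_neg mult_left_mono) auto
      then show ?thesis
        using ok unfolding line_search_ok_def a'_eq by linarith
    qed
    also have "\<dots> \<le> L (F a) + c * (\<tau> * \<eta>\<^sub>0) * (prox_model L F t a d' - L (F a))"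
      using glpa_directionD[OF d, of d'] c_bounds \<tau>_bounds \<open>0 < \<eta>\<^sub>0\<close>
      by (intro add_left_mono mult_left_mono) auto
    finally show ?thesis .
  qed
  moreover have "c * (\<tau> * \<eta>\<^sub>0) > 0"
    using c_bounds \<tau>_bounds \<open>0 < \<eta>\<^sub>0\<close> by simp
  ultimately show thesis using that by blast
qed

text \<open>Objective values decrease and are bounded below, so \<open>\<Phi> (s k)\<close> and
  \<open>\<Phi> (Suc (s k))\<close> share one limit \<open>l\<close>. In the limit, the sufficient
  decrease inequality excludes a negative model decrease at the cluster point.\<close>

lemma cluster_point_stationary:
  assumes run: "\<And>k. glpa_next (\<theta> k) (\<theta> (Suc k))"
    and s: "strict_mono s" and lim: "(\<theta> \<circ> s) \<longlonglongrightarrow> a"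
  shows "L (F a) \<le> prox_model L F t a d"
proof -
  define \<Phi> where "\<Phi> k = L (F (\<theta> k))" for k
  have "decseq \<Phi>"
    using glpa_next_nonincreasing[OF run] unfolding \<Phi>_def by (intro decseq_SucI)
  moreover have "Lmin \<le> \<Phi> k" for k
    unfolding \<Phi>_def by (rule Lmin_le)
  ultimately obtain l where l: "\<Phi> \<longlonglongrightarrow> l"
    using decseq_convergent by blast
  have \<Phi>s: "(\<lambda>k. \<Phi> (s k)) \<longlonglongrightarrow> l" and \<Phi>Suc: "(\<lambda>k. \<Phi> (Suc (s k))) \<longlonglongrightarrow> l"
    using LIMSEQ_subseq_LIMSEQ[OF l s] LIMSEQ_subseq_LIMSEQ[OF LIMSEQ_Suc[OF l] s]
    by (simp_all add: o_def)
  have "(\<lambda>k. \<Phi> (s k)) \<longlonglongrightarrow> L (F a)"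
    using isCont_tendsto_compose[OF isCont_o2[OF isCont_F isCont_L] lim]
    by (simp add: \<Phi>_def o_def)
  with \<Phi>s have l_eq: "l = L (F a)"
    by (rule LIMSEQ_unique)
  have "Bseq (\<theta> \<circ> s)"
    using lim by (intro convergent_imp_Bseq) (auto simp: convergent_def)
  then obtain R where R: "\<And>k. norm (\<theta> (s k)) \<le> R"
    unfolding Bseq_def by auto
  obtain \<delta> where "\<delta> > 0" and \<delta>: "\<And>b b' d'. \<lbrakk>norm b \<le> R; glpa_next b b'\<rbrakk> \<Longrightarrow>
      L (F b') \<le> L (F b) + \<delta> * (prox_model L F t b d' - L (F b))"
    using glpa_next_sufficient_decrease[where R = R] by blast
  have "l \<le> l + \<delta> * (prox_model L F t a d - l)"
  proof (rule LIMSEQ_le[OF \<Phi>Suc])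
    have "(\<lambda>k. prox_model L F t (\<theta> (s k)) d) \<longlonglongrightarrow> prox_model L F t a d"
      using isCont_tendsto_compose[OF isCont_prox_model lim] by (simp add: o_def)
    then show "(\<lambda>k. \<Phi> (s k) + \<delta> * (prox_model L F t (\<theta> (s k)) d - \<Phi> (s k)))
        \<longlonglongrightarrow> l + \<delta> * (prox_model L F t a d - l)"
      by (intro tendsto_intros \<Phi>s)
    show "\<exists>N. \<forall>k\<ge>N. \<Phi> (Suc (s k)) \<le> \<Phi> (s k) + \<delta> * (prox_model L F t (\<theta> (s k)) d - \<Phi> (s k))"
      unfolding \<Phi>_def using \<delta>[OF R run] by blast
  qed
  then show ?thesis
    using \<open>\<delta> > 0\<close> l_eq by (simp add: zero_le_mult_iff)
qed

text \<open>By convexity the direction \<open>d\<close> scaled by \<open>s\<close> gains at least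
  \<open>s\<close> times the full gap, while its quadratic term costs only order \<open>s\<close>
  squared; letting \<open>s\<close> tend to \<open>0\<close> rules out a positive gap.\<close>

lemma stationary_linearization_minimal:
  assumes "\<And>d. L (F a) \<le> prox_model L F t a d"
  shows "L (F a) \<le> L (F a + J a d)"
proof (rule ccontr)
  assume "\<not> ?thesis"
  then have gap: "0 < L (F a) - L (F a + J a d)" by simp
  define N where "N = (norm d)\<^sup>2 / (2 * t)"
  have bound: "L (F a) - L (F a + J a d) \<le> s * N" if "0 < s" "s \<le> 1" for s
  proof -
    have "L (F a) \<le> prox_model L F t a (s *\<^sub>R d)"
      by (rule assms)
    also have "\<dots> = L ((1 - s) *\<^sub>R F a + s *\<^sub>R (F a + J a d)) + s * (s * N)"
      by (simp add: prox_model_def N_def J_scaleR power_mult_distrib power2_eq_square algebra_simps)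
    also have "\<dots> \<le> (1 - s) * L (F a) + s * L (F a + J a d) + s * (s * N)"
      using that by (intro add_right_mono convex_onD[OF convex_L]) auto
    finally have "s * (L (F a) - L (F a + J a d)) \<le> s * (s * N)"
      by (simp add: algebra_simps)
    then show ?thesis using that by simp
  qed
  have "((\<lambda>s. s * N) \<longlongrightarrow> 0 * N) (at_right 0)"
    by (intro tendsto_intros)
  moreover have "\<forall>\<^sub>F s in at_right 0. L (F a) - L (F a + J a d) \<le> s * N"
    using eventually_at_right_less[of "0::real"] eventually_at_right_real[OF zero_less_one]
    by eventually_elim (auto intro: bound)
  ultimately have "L (F a) - L (F a + J a d) \<le> 0 * N"
    by (intro tendsto_lowerbound) auto
  with gap show False by simp
qed

section \<open>Regular points\<close>

text \<open>The kernel of the transpose is the orthogonal complement of the range of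
  \<open>J a\<close>; in this form regularity can be applied to separating normals.\<close>

lemma regular_pointD:
  assumes "regular_point F (argmin_set L) a"
    and "\<And>h. y \<bullet> J a h = 0" and "\<And>z. z \<in> argmin_set L \<Longrightarrow> y \<bullet> (z - F a) \<le> 0"
  shows "y = 0"
proof -
  have "(transpose (jacobian F (at a)) *v y) \<bullet> h = 0" for h
    using assms(2)[of h] by (simp add: dot_lmul_matrix transpose_matrix_vector)
  then have "transpose (jacobian F (at a)) *v y = 0"
    by (metis inner_eq_zero_iff)
  moreover have "y \<in> neg_polar ((\<lambda>c. c - F a) ` argmin_set L)"
    using assms(3) by (auto simp: neg_polar_def)
  ultimately show ?thesis
    using assms(1) unfolding regular_point_def by blast
qed

text \<open>A linear functional that is bounded below on a vector space vanishes.\<close>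

lemma inner_range_J_eq_0:
  assumes "\<And>h. w \<le> y \<bullet> J a h"
  shows "y \<bullet> J a h = 0"
proof (rule ccontr)
  assume "y \<bullet> J a h \<noteq> 0"
  then show False
    \<comment> \<open>At this multiple of \<open>h\<close> the functional has the value
      \<open>w - 1\<close>, below the bound \<open>w\<close>.\<close>
    using assms[of "((w - 1) / (y \<bullet> J a h)) *\<^sub>R h"] by (simp add: J_scaleR)
qed

text \<open>The residuals are the image of a product of convex sets under an affine map. Used with
  \<open>S = UNIV\<close> and with the unit ball.\<close>

lemma convex_linearized_residuals:
  assumes "convex S"
  shows "convex {z - F a - J a d | z d. z \<in> argmin_set L \<and> d \<in> S}" (is "convex ?D")
proof (rule convexI)
  fix p q and u v :: real
  assume "p \<in> ?D" "q \<in> ?D" and uv: "0 \<le> u" "0 \<le> v" "u + v = 1"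
  then obtain z d z' d' where eq: "p = z - F a - J a d" "q = z' - F a - J a d'"
    and z: "z \<in> argmin_set L" "z' \<in> argmin_set L" and d: "d \<in> S" "d' \<in> S"
    by blast
  have "u *\<^sub>R p + v *\<^sub>R q
      = (u *\<^sub>R z + v *\<^sub>R z') - (u + v) *\<^sub>R F a - J a (u *\<^sub>R d + v *\<^sub>R d')"
    by (simp add: eq J_add J_scaleR algebra_simps)
  moreover have "u *\<^sub>R z + v *\<^sub>R z' \<in> argmin_set L" "u *\<^sub>R d + v *\<^sub>R d' \<in> S"
    using convexD[OF convex_argmin z uv] convexD[OF assms d uv] .
  ultimately show "u *\<^sub>R p + v *\<^sub>R q \<in> ?D"
    unfolding uv(3) scaleR_one by blast
qed

text \<open>Were the linearized inclusion unsolvable, a normal separating \<open>0\<close> from the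
  convex set \<open>D\<close> would violate regularity. A solution \<open>d\<close> makes the
  linearized value \<open>Lmin\<close>, and \<open>min\<close> allows no linearized value below
  \<open>L (F a)\<close>.\<close>

lemma regular_stationary_imp_argmin:
  assumes reg: "regular_point F (argmin_set L) a"
    and min: "\<And>d. L (F a) \<le> L (F a + J a d)"
  shows "F a \<in> argmin_set L"
proof -
  define D where "D = {z - F a - J a d | z d. z \<in> argmin_set L \<and> d \<in> UNIV}"
  have "convex D"
    unfolding D_def by (rule convex_linearized_residuals) simp
  have "0 \<in> D"
  proof (rule ccontr)
    assume "0 \<notin> D"
    from separating_hyperplane_set_0[OF \<open>convex D\<close> this]
    obtain y where "y \<noteq> 0" and y: "\<And>p. p \<in> D \<Longrightarrow> 0 \<le> y \<bullet> p" by blast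
    have y': "y \<bullet> J a d \<le> y \<bullet> (z - F a)" if "z \<in> argmin_set L" for z d
      using y[of "z - F a - J a d"] that unfolding D_def by (auto simp: inner_diff_right)
    obtain z0 where z0: "z0 \<in> argmin_set L" using argmin_nonempty by blast
    \<comment> \<open>The functional is bounded below on the range of \<open>J a\<close>, hence zero
      there; the sign change will place the normal in the negative polar.\<close>
    have "- y \<bullet> J a d = 0" for d
      by (rule inner_range_J_eq_0[where w = "- (y \<bullet> (z0 - F a))"]) (use y'[OF z0] in simp)
    moreover from this have "- y \<bullet> (z - F a) \<le> 0" if "z \<in> argmin_set L" for z
      using y'[OF that, of 0] by (simp add: J_zero)
    ultimately have "- y = 0"
      by (rule regular_pointD[OF reg])
    with \<open>y \<noteq> 0\<close> show False by simp
  qed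
  then obtain z d where "z \<in> argmin_set L" "F a + J a d = z"
    unfolding D_def by (auto simp: algebra_simps)
  then have "L (F a + J a d) = Lmin"
    using L_eq_Lmin_iff by blast
  then have "L (F a) = Lmin"
    using min[of d] Lmin_le[of "F a"] by linarith
  then show ?thesis
    using L_eq_Lmin_iff by blast
qed

text \<open>If this failed, there would be unit normals separating points \<open>p \<rightarrow> 0\<close> from the convex sets
  \<open>argmin_set L - F b - J b (cball 0 1)\<close>, with \<open>b \<rightarrow> a\<close>; a limit of these normals contradicts
  the regularity of \<open>a\<close>.\<close>

lemma regular_uniform_interior:
  assumes reg: "regular_point F (argmin_set L) a" and Fa: "F a \<in> argmin_set L"
  obtains \<rho> where "\<rho> > 0"
    "\<And>b p. \<lbrakk>norm (b - a) < \<rho>; norm p < \<rho>\<rbrakk> \<Longrightarrow>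
       \<exists>z\<in>argmin_set L. \<exists>d. norm d \<le> 1 \<and> p = z - F b - J b d"
proof -
  define D where "D b = {z - F b - J b d | z d. z \<in> argmin_set L \<and> d \<in> cball 0 1}" for b
  have convex_D: "convex (D b)" for b
    unfolding D_def by (rule convex_linearized_residuals) simp
  have "\<exists>\<rho>>0. \<forall>b p. norm (b - a) < \<rho> \<longrightarrow> norm p < \<rho> \<longrightarrow> p \<in> D b"
  proof (rule ccontr)
    assume "\<not> ?thesis"
    then have "\<exists>b p. norm (b - a) < inverse (real (Suc n)) \<and> norm p < inverse (real (Suc n)) \<and> p \<notin> D b"
      for n
      by (metis inverse_positive_iff_positive of_nat_0_less_iff zero_less_Suc)
    then obtain b p where b: "\<And>n. norm (b n - a) < inverse (real (Suc n))"
      and p: "\<And>n. norm (p n) < inverse (real (Suc n))" and notin: "\<And>n. p n \<notin> D (b n)"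
      by metis
    have b_lim: "b \<longlonglongrightarrow> a"
      using LIMSEQ_norm_0[of "\<lambda>n. b n - a"] b Lim_null
      by (metis inverse_eq_divide)
    have p_lim: "p \<longlonglongrightarrow> 0"
      using p by (intro LIMSEQ_norm_0) (simp add: inverse_eq_divide)
    \<comment> \<open>Normalization by \<open>sgn\<close> places the normals on the unit sphere,
      whose compactness keeps their limit nonzero.\<close>
    have "\<exists>y. norm y = 1 \<and> (\<forall>q\<in>D (b n). y \<bullet> p n \<le> y \<bullet> q)" for n
    proof -
      have "convex ((\<lambda>q. q - p n) ` D (b n))"
        using convex_translation_subtract[OF convex_D] .
      moreover have "0 \<notin> (\<lambda>q. q - p n) ` D (b n)"
        using notin by auto
      ultimately obtain y where "y \<noteq> 0" "\<forall>q\<in>(\<lambda>q. q - p n) ` D (b n). 0 \<le> y \<bullet> q"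
        by (metis separating_hyperplane_set_0)
      then have "\<forall>q\<in>D (b n). sgn y \<bullet> p n \<le> sgn y \<bullet> q"
        by (auto simp: sgn_div_norm inner_diff_right intro: mult_left_mono)
      with \<open>y \<noteq> 0\<close> show ?thesis
        by (intro exI[of _ "sgn y"]) (simp add: norm_sgn)
    qed
    then obtain y where y1: "\<And>n. norm (y n) = 1"
      and y: "\<And>n q. q \<in> D (b n) \<Longrightarrow> y n \<bullet> p n \<le> y n \<bullet> q"
      by metis
    have "seq_compact (sphere (0 :: real ^ 'm) 1)"
      by (intro compact_imp_seq_compact compact_sphere)
    then obtain y\<^sub>0 s where "y\<^sub>0 \<in> sphere 0 1" and s: "strict_mono s" and ys: "(y \<circ> s) \<longlonglongrightarrow> y\<^sub>0"
      using y1 unfolding seq_compact_def by (metis dist_0_norm mem_sphere)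
    have lim: "0 \<le> y\<^sub>0 \<bullet> (z - F a - J a d)" if z: "z \<in> argmin_set L" and d: "norm d \<le> 1" for z d
    proof -
      have bs: "(\<lambda>n. b (s n)) \<longlonglongrightarrow> a" and ps: "(\<lambda>n. p (s n)) \<longlonglongrightarrow> 0"
        using LIMSEQ_subseq_LIMSEQ[OF b_lim s] LIMSEQ_subseq_LIMSEQ[OF p_lim s] by (simp_all add: o_def)
      have ys': "(\<lambda>n. y (s n)) \<longlonglongrightarrow> y\<^sub>0" using ys by (simp add: o_def)
      have "(\<lambda>n. y (s n) \<bullet> p (s n)) \<longlonglongrightarrow> y\<^sub>0 \<bullet> 0"
        by (intro tendsto_inner ys' ps)
      moreover have "(\<lambda>n. y (s n) \<bullet> (z - F (b (s n)) - J (b (s n)) d)) \<longlonglongrightarrow> y\<^sub>0 \<bullet> (z - F a - J a d)"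
        by (intro tendsto_intros ys' isCont_tendsto_compose[OF isCont_F bs]
            isCont_tendsto_compose[OF isCont_J bs])
      moreover have "y (s n) \<bullet> p (s n) \<le> y (s n) \<bullet> (z - F (b (s n)) - J (b (s n)) d)" for n
        using z d by (intro y) (auto simp: D_def)
      ultimately have "y\<^sub>0 \<bullet> 0 \<le> y\<^sub>0 \<bullet> (z - F a - J a d)"
        by (intro LIMSEQ_le) auto
      then show ?thesis by simp
    qed
    \<comment> \<open>\<open>lim\<close> covers only directions of norm at most 1, hence
      \<open>sgn d\<close> and its negative, both taken at \<open>z = F a\<close>; homogeneity
      extends the result to \<open>d\<close>.\<close>
    have "- y\<^sub>0 \<bullet> J a d = 0" for d
    proof -
      have "0 \<le> - y\<^sub>0 \<bullet> J a (sgn d)" "0 \<le> - y\<^sub>0 \<bullet> J a (- sgn d)"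
        using lim[OF Fa, of "sgn d"] lim[OF Fa, of "- sgn d"] by (auto simp: norm_sgn)
      moreover have "J a (- sgn d) = - J a (sgn d)"
        using J_scaleR[of a "-1" "sgn d"] by simp
      moreover have "J a d = norm d *\<^sub>R J a (sgn d)"
        by (cases "d = 0") (simp_all add: sgn_div_norm J_zero flip: J_scaleR)
      ultimately show ?thesis by simp
    qed
    moreover have "- y\<^sub>0 \<bullet> (z - F a) \<le> 0" if "z \<in> argmin_set L" for z
      using lim[OF that, of 0] by (simp add: J_zero)
    ultimately have "- y\<^sub>0 = 0"
      by (rule regular_pointD[OF reg])
    with \<open>y\<^sub>0 \<in> sphere 0 1\<close> show False by simp
  qed
  then obtain \<rho> where "\<rho> > 0" "\<And>b p. norm (b - a) < \<rho> \<Longrightarrow> norm p < \<rho> \<Longrightarrow> p \<in> D b"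
    by blast
  then show thesis
    unfolding D_def mem_cball_0 by (intro that[of \<rho>]) blast+
qed

section \<open>The residual and the linearized inclusion near a regular point\<close>

abbreviation residual :: "real ^ 'n \<Rightarrow> real" where
  "residual a \<equiv> infdist (F a) (argmin_set L)"

text \<open>Two approximate solutions at \<open>b\<close> are combined: direction \<open>0\<close>
  misses by the shift \<open>e\<close> to the nearest minimizer, and
  \<open>regular_uniform_interior\<close> supplies a \<open>d\<close> with a shift opposite to
  \<open>e\<close>. Convex weights that cancel the shifts give an exact solution, with a weight of
  order \<open>D\<close> on \<open>d\<close>.\<close>

lemma regular_error_bound:
  assumes reg: "regular_point F (argmin_set L) a" and Fa: "F a \<in> argmin_set L"
  obtains \<kappa> where "\<kappa> > 0"
    "\<forall>\<^sub>F b in nhds a. \<exists>d. F b + J b d \<in> argmin_set L \<and> norm d \<le> \<kappa> * residual b"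
proof -
  obtain \<rho> where "\<rho> > 0" and \<rho>: "\<And>b p. \<lbrakk>norm (b - a) < \<rho>; norm p < \<rho>\<rbrakk> \<Longrightarrow>
       \<exists>z\<in>argmin_set L. \<exists>d. norm d \<le> 1 \<and> p = z - F b - J b d"
    using regular_uniform_interior[OF reg Fa] by blast
  have "\<exists>d. F b + J b d \<in> argmin_set L \<and> norm d \<le> (2 / \<rho>) * residual b" if b: "norm (b - a) < \<rho>" for b
  proof (cases "residual b = 0")
    case True
    then have "F b \<in> argmin_set L"
      using closed_argmin argmin_nonempty in_closed_iff_infdist_zero by blast
    then show ?thesis by (intro exI[of _ 0]) (simp add: J_zero True)
  next
    case False
    define D where "D = residual b"
    have "D > 0" using False infdist_nonneg[of "F b"] by (simp add: D_def order_less_le)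
    obtain z\<^sub>0 where z\<^sub>0: "z\<^sub>0 \<in> argmin_set L" and D: "D = dist (F b) z\<^sub>0"
      using infdist_attains_inf[OF closed_argmin argmin_nonempty] unfolding D_def by metis
    define e where "e = z\<^sub>0 - F b"
    have e: "norm e = D" by (simp add: D e_def dist_norm norm_minus_commute)
    \<comment> \<open>The factor scales the opposite of \<open>e\<close> to norm
      \<open>\<rho> / 2\<close>.\<close>
    have "norm (- (\<rho> / (2 * D)) *\<^sub>R e) < \<rho>"
      using \<open>\<rho> > 0\<close> \<open>D > 0\<close> by (simp add: e)
    from \<rho>[OF b this] obtain z d where z: "z \<in> argmin_set L" and "norm d \<le> 1"
      and eq: "- (\<rho> / (2 * D)) *\<^sub>R e = z - F b - J b d"
      by blast
    \<comment> \<open>Solves \<open>1 - s = s * (\<rho> / (2 * D))\<close>, so that the two shifts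
      cancel.\<close>
    define s where "s = 2 * D / (\<rho> + 2 * D)"
    have s: "0 \<le> s" "s \<le> 1" "1 - s = s * (\<rho> / (2 * D))"
      using \<open>\<rho> > 0\<close> \<open>D > 0\<close> by (auto simp: s_def field_simps)
    have "(1 - s) *\<^sub>R z\<^sub>0 + s *\<^sub>R z - (F b + J b (s *\<^sub>R d))
        = (1 - s) *\<^sub>R e + s *\<^sub>R (z - F b - J b d)"
      by (simp add: e_def J_scaleR algebra_simps)
    also have "\<dots> = (1 - s - s * (\<rho> / (2 * D))) *\<^sub>R e"
      unfolding eq[symmetric] by (simp add: scaleR_diff_left)
    also have "\<dots> = 0" using s by simp
    finally have "F b + J b (s *\<^sub>R d) = (1 - s) *\<^sub>R z\<^sub>0 + s *\<^sub>R z"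
      by simp
    moreover have "(1 - s) *\<^sub>R z\<^sub>0 + s *\<^sub>R z \<in> argmin_set L"
      using convexD[OF convex_argmin z\<^sub>0 z, of "1 - s" s] s(1,2) by simp
    moreover have "norm (s *\<^sub>R d) \<le> (2 / \<rho>) * D"
    proof -
      have "norm (s *\<^sub>R d) \<le> s"
        using s \<open>norm d \<le> 1\<close> by (simp add: mult_left_le)
      also have "s \<le> 2 * D / \<rho>"
        unfolding s_def using \<open>\<rho> > 0\<close> \<open>D > 0\<close> by (intro divide_left_mono) auto
      finally show ?thesis by simp
    qed
    ultimately show ?thesis
      unfolding D_def by metis
  qed
  then have "\<forall>\<^sub>F b in nhds a. \<exists>d. F b + J b d \<in> argmin_set L \<and> norm d \<le> (2 / \<rho>) * residual b"
    unfolding eventually_nhds_metric dist_norm using \<open>\<rho> > 0\<close> by blast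
  then show thesis
    using that[of "2 / \<rho>"] \<open>\<rho> > 0\<close> by simp
qed

end

section \<open>Rate of convergence\<close>

text \<open>The step lengths telescope: \<open>D\<close> at least halves in each step near \<open>l\<close>, hence
  \<open>\<kappa> * D a \<le> 2 * \<kappa> * (D a - D a')\<close> for consecutive iterates \<open>a\<close>, \<open>a'\<close>.\<close>

lemma converges_with_order_of_residual:
  fixes X :: "nat \<Rightarrow> 'a::real_normed_vector" and D :: "'a \<Rightarrow> real"
  assumes s: "strict_mono s" and lim: "(X \<circ> s) \<longlonglongrightarrow> l"
    and pos: "\<kappa> > 0" "M > 0" "K > 0" and \<gamma>: "\<gamma> > 1"
    and D_nonneg: "\<And>a. 0 \<le> D a"
    and D_le: "\<forall>\<^sub>F a in nhds l. D a \<le> K * norm (a - l)"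
    and step: "\<forall>\<^sub>F a in nhds l. \<forall>k. X k = a \<longrightarrow>
      norm (X (Suc k) - a) \<le> \<kappa> * D a \<and> D (X (Suc k)) \<le> M * D a powr \<gamma>"
  shows "converges_with_order X l \<gamma>"
proof -
  have "((\<lambda>a. K * norm (a - l)) \<longlongrightarrow> K * norm (l - l)) (nhds l)"
    by (intro tendsto_intros filterlim_ident)
  then have D_lim: "(D \<longlongrightarrow> 0) (nhds l)"
    by (intro tendsto_sandwich[OF _ D_le tendsto_const]) (auto simp: D_nonneg)
  \<comment> \<open>Here \<open>\<gamma> > 1\<close> enters: the contraction factor of
    \<open>D\<close> tends to \<open>0\<close> near \<open>l\<close>.\<close>
  have "((\<lambda>a. M * D a powr (\<gamma> - 1)) \<longlongrightarrow> M * 0) (nhds l)"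
    using \<gamma> by (intro tendsto_mult tendsto_const tendsto_zero_powrI[OF D_lim tendsto_const])
      (auto simp: D_nonneg)
  then have "\<forall>\<^sub>F a in nhds l. M * D a powr (\<gamma> - 1) < 1 / 2"
    by (intro order_tendstoD) auto
  with D_le step have "\<forall>\<^sub>F a in nhds l. D a \<le> K * norm (a - l) \<and> M * D a powr (\<gamma> - 1) < 1 / 2 \<and>
      (\<forall>k. X k = a \<longrightarrow> norm (X (Suc k) - a) \<le> \<kappa> * D a \<and> D (X (Suc k)) \<le> M * D a powr \<gamma>)"
    by eventually_elim auto
  then obtain \<epsilon> where "\<epsilon> > 0" and near: "\<And>a. norm (a - l) < \<epsilon> \<Longrightarrow>
      D a \<le> K * norm (a - l) \<and> M * D a powr (\<gamma> - 1) < 1 / 2 \<and>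
      (\<forall>k. X k = a \<longrightarrow> norm (X (Suc k) - a) \<le> \<kappa> * D a \<and> D (X (Suc k)) \<le> M * D a powr \<gamma>)"
    unfolding eventually_nhds_metric dist_norm by blast
  have next_le: "norm (X (Suc k) - X k) \<le> 2 * \<kappa> * (D (X k) - D (X (Suc k)))"
    if "norm (X k - l) < \<epsilon>" for k
  proof -
    have step_k: "norm (X (Suc k) - X k) \<le> \<kappa> * D (X k)"
      using near[OF that] by auto
    have "D (X (Suc k)) \<le> M * D (X k) powr \<gamma>"
      using near[OF that] by auto
    also have "M * D (X k) powr \<gamma> = (M * D (X k) powr (\<gamma> - 1)) * D (X k)"
      using D_nonneg[of "X k"] powr_add[of "D (X k)" "\<gamma> - 1" 1] by simp
    also have "\<dots> \<le> 1 / 2 * D (X k)"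
      using near[OF that] D_nonneg by (intro mult_right_mono) auto
    finally have "\<kappa> * (2 * D (X (Suc k))) \<le> \<kappa> * D (X k)"
      using pos by (intro mult_left_mono) auto
    then show ?thesis
      using step_k by (simp add: algebra_simps)
  qed
  have Ds_lim: "(\<lambda>n. D (X (s n))) \<longlonglongrightarrow> 0"
    using filterlim_compose[OF D_lim lim] by (simp add: o_def)
  then have "(\<lambda>n. 2 * \<kappa> * D (X (s n))) \<longlonglongrightarrow> 2 * \<kappa> * 0"
    by (intro tendsto_intros)
  then have "\<forall>\<^sub>F n in sequentially. 2 * \<kappa> * D (X (s n)) < \<epsilon> / 2"
    using \<open>\<epsilon> > 0\<close> by (intro order_tendstoD) auto
  moreover have "\<forall>\<^sub>F n in sequentially. norm (X (s n) - l) < \<epsilon> / 2"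
    using tendstoD[OF lim, of "\<epsilon> / 2"] \<open>\<epsilon> > 0\<close> by (simp add: o_def dist_norm)
  ultimately have "\<forall>\<^sub>F n in sequentially. 2 * \<kappa> * D (X (s n)) < \<epsilon> / 2 \<and> norm (X (s n) - l) < \<epsilon> / 2"
    by (rule eventually_conj)
  then obtain n where n: "2 * \<kappa> * D (X (s n)) < \<epsilon> / 2" "norm (X (s n) - l) < \<epsilon> / 2"
    using eventually_happens' sequentially_bot by blast
  define N where "N = s n"
  \<comment> \<open>The total displacement from \<open>X N\<close> is at most
    \<open>2 * \<kappa> * D (X N)\<close>, less than \<open>\<epsilon> / 2\<close>, so the iterates
    never leave the ball of radius \<open>\<epsilon>\<close> in which \<open>next_le\<close>
    applies.\<close>
  have stay: "norm (X k - l) < \<epsilon> \<and> norm (X k - X N) \<le> 2 * \<kappa> * (D (X N) - D (X k))" if "k \<ge> N" for k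
    using that
  proof (induction k rule: dec_induct)
    case base
    then show ?case using n \<open>\<epsilon> > 0\<close> by (simp add: N_def)
  next
    case (step k)
    have "norm (X (Suc k) - X N) \<le> norm (X (Suc k) - X k) + norm (X k - X N)"
      using norm_triangle_ineq[of "X (Suc k) - X k" "X k - X N"] by simp
    also have "\<dots> \<le> 2 * \<kappa> * (D (X k) - D (X (Suc k))) + 2 * \<kappa> * (D (X N) - D (X k))"
      using next_le step.IH by (intro add_mono) auto
    finally have 1: "norm (X (Suc k) - X N) \<le> 2 * \<kappa> * (D (X N) - D (X (Suc k)))"
      by (simp add: algebra_simps)
    have "0 \<le> 2 * \<kappa> * D (X (Suc k))" using pos D_nonneg by simp
    with 1 have "norm (X (Suc k) - X N) < \<epsilon> / 2"
      using n(1) by (simp add: N_def algebra_simps)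
    then have "norm (X (Suc k) - l) < \<epsilon>"
      using n(2) norm_triangle_ineq[of "X (Suc k) - X N" "X N - l"] by (simp add: N_def)
    with 1 show ?case by blast
  qed
  have telescope: "norm (X j - X i) \<le> 2 * \<kappa> * (D (X i) - D (X j))" if "N \<le> i" "i \<le> j" for i j
    using that(2)
  proof (induction j rule: dec_induct)
    case (step j)
    have "norm (X (Suc j) - X i) \<le> norm (X (Suc j) - X j) + norm (X j - X i)"
      using norm_triangle_ineq[of "X (Suc j) - X j" "X j - X i"] by simp
    also have "\<dots> \<le> 2 * \<kappa> * (D (X j) - D (X (Suc j))) + 2 * \<kappa> * (D (X i) - D (X j))"
      using next_le stay[of j] step that(1) by (intro add_mono) auto
    finally show ?case by (simp add: algebra_simps)
  qed simp
  \<comment> \<open>The telescoped bound for \<open>X (s n)\<close> with \<open>s n \<ge> i\<close>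
    passes to the limit along the subsequence.\<close>
  have dist_le: "norm (X i - l) \<le> 2 * \<kappa> * D (X i)" if "N \<le> i" for i
  proof -
    have "(\<lambda>n. norm (X (s n) - X i)) \<longlonglongrightarrow> norm (l - X i)"
      using lim by (intro tendsto_intros) (simp add: o_def)
    moreover have "\<forall>\<^sub>F n in sequentially. norm (X (s n) - X i) \<le> 2 * \<kappa> * D (X i)"
      using eventually_ge_at_top[of i]
    proof eventually_elim
      case (elim n)
      then have "i \<le> s n" using seq_suble[OF s, of n] by simp
      then have "norm (X (s n) - X i) \<le> 2 * \<kappa> * (D (X i) - D (X (s n)))"
        using telescope that by blast
      moreover have "0 \<le> 2 * \<kappa> * D (X (s n))" using pos D_nonneg by simp
      ultimately show ?case by (simp add: algebra_simps)
    qed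
    ultimately have "norm (l - X i) \<le> 2 * \<kappa> * D (X i)"
      by (intro tendsto_upperbound) auto
    then show ?thesis by (simp add: norm_minus_commute)
  qed
  have "X \<longlonglongrightarrow> l"
  proof (rule LIMSEQ_I)
    fix e :: real assume "e > 0"
    then have "\<forall>\<^sub>F n in sequentially. 2 * \<kappa> * D (X (s n)) < e"
      using \<open>(\<lambda>n. 2 * \<kappa> * D (X (s n))) \<longlonglongrightarrow> 2 * \<kappa> * 0\<close> by (intro order_tendstoD) auto
    then have "\<forall>\<^sub>F n in sequentially. 2 * \<kappa> * D (X (s n)) < e \<and> N \<le> n"
      using eventually_ge_at_top[of N] by (rule eventually_conj)
    then obtain n' where n': "2 * \<kappa> * D (X (s n')) < e" "N \<le> n'"
      using eventually_happens' sequentially_bot by blast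
    then have "N \<le> s n'" using seq_suble[OF s, of n'] by simp
    have "norm (X k - l) < e" if "k \<ge> s n'" for k
    proof -
      \<comment> \<open>The left side of \<open>telescope\<close> is nonnegative, so
        \<open>D\<close> at later iterates does not exceed its value at \<open>s n'\<close>.\<close>
      have "0 \<le> 2 * \<kappa> * (D (X (s n')) - D (X k))"
        using telescope[OF \<open>N \<le> s n'\<close> that] norm_ge_zero order_trans by blast
      then show ?thesis
        using dist_le[of k] \<open>N \<le> s n'\<close> that n' by (simp add: algebra_simps)
    qed
    then show "\<exists>k0. \<forall>k\<ge>k0. norm (X k - l) < e" by blast
  qed
  \<comment> \<open>\<open>2 * \<kappa>\<close> stems from \<open>dist_le\<close>, \<open>M\<close>
    from the step bound on \<open>D\<close>, and \<open>K powr \<gamma>\<close> from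
    \<open>D_le\<close>.\<close>
  moreover have "norm (X (Suc k) - l) \<le> (2 * \<kappa> * M * K powr \<gamma>) * norm (X k - l) powr \<gamma>" if "k \<ge> N" for k
  proof -
    have "norm (X (Suc k) - l) \<le> 2 * \<kappa> * D (X (Suc k))"
      using dist_le[of "Suc k"] that by simp
    also have "\<dots> \<le> 2 * \<kappa> * (M * D (X k) powr \<gamma>)"
      using near[of "X k"] stay[OF that] pos by (intro mult_left_mono) auto
    also have "\<dots> \<le> 2 * \<kappa> * (M * (K * norm (X k - l)) powr \<gamma>)"
      using near[of "X k"] stay[OF that] pos \<gamma> D_nonneg by (intro mult_left_mono powr_mono2) auto
    finally show ?thesis
      using pos by (simp add: powr_mult mult.assoc)
  qed
  ultimately show ?thesis
    unfolding converges_with_order_def eventually_sequentially using pos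
    by (intro conjI exI[of _ "2 * \<kappa> * M * K powr \<gamma>"]) auto
qed

section \<open>One step of the algorithm near a regular minimum\<close>

context composite_problem
begin

lemma residual_le:
  assumes "F a \<in> argmin_set L"
  obtains K where "K > 0" "\<forall>\<^sub>F b in nhds a. residual b \<le> K * norm (b - a)"
proof -
  obtain K where "K > 0" and K: "\<And>b b'. \<lbrakk>norm b \<le> norm a + 1; norm b' \<le> norm a + 1\<rbrakk> \<Longrightarrow>
      norm (F b - F b') \<le> K * norm (b - b')"
    using F_lipschitz_on_cball[where R = "norm a + 1"] by blast
  have "residual b \<le> K * norm (b - a)" if "dist b a < 1" for b
  proof -
    have "residual b \<le> norm (F b - F a)"
      using infdist_le[OF assms, of "F b"] by (simp add: dist_norm)
    also have "\<dots> \<le> K * norm (b - a)"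
      using norm_triangle_sub[of b a] that by (intro K) (auto simp: dist_norm)
    finally show ?thesis .
  qed
  then have "\<forall>\<^sub>F b in nhds a. residual b \<le> K * norm (b - a)"
    unfolding eventually_nhds_metric using zero_less_one by blast
  with \<open>K > 0\<close> show thesis by (rule that)
qed

text \<open>\<open>growth\<close> acts twice: at \<open>F b\<close> it makes the current gap
  dominate the error terms, so that the unit step passes; at the linearized point \<open>z\<close>
  it turns a small gap into a small distance to the minimizers.\<close>

lemma glpa_step_near_regular_minimum:
  assumes reg: "regular_point F (argmin_set L) a" and Fa: "F a \<in> argmin_set L"
    and "r > 0" "\<alpha> > 0" and \<beta>: "1 \<le> \<beta>" "\<beta> < 2"
    and growth: "\<And>z. z \<in> ball (F a) r \<Longrightarrow> Lmin + \<alpha> * infdist z (argmin_set L) powr \<beta> \<le> L z"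
  obtains \<kappa> M where "\<kappa> > 0" "M > 0" "\<forall>\<^sub>F b in nhds a. \<forall>b'. glpa_next b b' \<longrightarrow>
    norm (b' - b) \<le> \<kappa> * residual b \<and> residual b' \<le> M * residual b powr (2 / \<beta>)"
proof -
  obtain \<kappa> where "\<kappa> > 0" and error_bound:
    "\<forall>\<^sub>F b in nhds a. \<exists>d. F b + J b d \<in> argmin_set L \<and> norm d \<le> \<kappa> * residual b"
    using regular_error_bound[OF reg Fa] by blast
  define R where "R = norm a + 1"
  have "R \<ge> 1" by (simp add: R_def)
  obtain Q where "Q > 0" and Q: "\<And>b h. \<lbrakk>norm b \<le> R; norm h \<le> R\<rbrakk> \<Longrightarrow>
      \<bar>L (F (b + h)) - L (F b + J b h)\<bar> \<le> Q * (norm h)\<^sup>2"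
    using linearization_error[where R = R] by blast
  obtain KJ where "KJ > 0" and KJ: "\<And>b h. norm b \<le> R \<Longrightarrow> norm (J b h) \<le> KJ * norm h"
    using J_bounded_on_cball[where R = R] by blast
  obtain K where "K > 0" and K: "\<And>b h. \<lbrakk>norm b \<le> 2 * R; norm (b + h) \<le> 2 * R\<rbrakk> \<Longrightarrow>
      norm (F (b + h) - (F b + J b h)) \<le> K * (norm h)\<^sup>2"
    using F_quadratic_error_on_cball[where R = "2 * R"] by blast
  \<comment> \<open>Relative to \<open>D\<^sup>2\<close>, \<open>A\<close> bounds the distance of
    \<open>z\<close> to the minimizers raised to the power \<open>\<beta>\<close>, and
    \<open>B\<close> bounds the gap after a unit step. \<open>M\<close> adds the residual of
    \<open>z\<close> and the linearization error of \<open>F\<close>.\<close>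
  define A where "A = \<kappa>\<^sup>2 / (2 * t * \<alpha>)"
  define B where "B = \<kappa>\<^sup>2 / (2 * t) + Q * \<kappa>\<^sup>2"
  define M where "M = A powr (1 / \<beta>) + K * \<kappa>\<^sup>2"
  have "A > 0" "M > 0"
    using \<open>\<kappa> > 0\<close> \<open>\<alpha> > 0\<close> \<open>K > 0\<close> t_pos by (auto simp: A_def M_def intro!: add_nonneg_pos)
  have F_lim: "(F \<longlongrightarrow> F a) (nhds a)"
    using isCont_F[of a] unfolding isCont_def tendsto_at_iff_tendsto_nhds .
  then have res_lim: "(residual \<longlongrightarrow> 0) (nhds a)"
    using tendsto_infdist[OF F_lim, of "argmin_set L"] Fa by simp
  have near_F: "\<forall>\<^sub>F b in nhds a. dist (F b) (F a) < r / 2"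
    using F_lim half_gt_zero[OF \<open>r > 0\<close>] by (rule tendstoD)
  have near_norm: "\<forall>\<^sub>F b in nhds a. norm b \<le> R"
  proof -
    have "norm b \<le> R" if "dist b a < 1" for b
      using norm_triangle_sub[of b a] that by (simp add: R_def dist_norm)
    then show ?thesis
      unfolding eventually_nhds_metric using zero_less_one by blast
  qed
  \<comment> \<open>Residuals below 1 allow
    \<open>D\<^sup>2 \<le> D powr (2 / \<beta>)\<close>.\<close>
  have small: "\<forall>\<^sub>F b in nhds a. residual b < 1"
    using res_lim by (intro order_tendstoD) auto
  have "((\<lambda>b. \<kappa> * residual b) \<longlongrightarrow> \<kappa> * 0) (nhds a)"
    by (intro tendsto_intros res_lim)
  then have small_step: "\<forall>\<^sub>F b in nhds a. \<kappa> * residual b < 1"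
    by (intro order_tendstoD) auto
  \<comment> \<open>Together with \<open>near_F\<close>, this keeps \<open>z\<close> in the ball
    where \<open>growth\<close> holds.\<close>
  have "((\<lambda>b. KJ * (\<kappa> * residual b)) \<longlongrightarrow> KJ * (\<kappa> * 0)) (nhds a)"
    by (intro tendsto_intros res_lim)
  then have small_J: "\<forall>\<^sub>F b in nhds a. KJ * (\<kappa> * residual b) < r / 2"
    using \<open>r > 0\<close> by (intro order_tendstoD) auto
  \<comment> \<open>The exponent \<open>2 - \<beta>\<close> is positive, so errors of order
    \<open>D\<^sup>2\<close> fall below the fraction \<open>1 - c\<close> of the growth
    \<open>\<alpha> * D powr \<beta>\<close>.\<close>
  have "((\<lambda>b. B * residual b powr (2 - \<beta>)) \<longlongrightarrow> B * 0) (nhds a)"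
    using \<beta> by (intro tendsto_mult tendsto_const tendsto_zero_powrI[OF res_lim tendsto_const])
      (auto simp: infdist_nonneg)
  then have small_B: "\<forall>\<^sub>F b in nhds a. B * residual b powr (2 - \<beta>) < (1 - c) * \<alpha>"
    using c_bounds \<open>\<alpha> > 0\<close> by (intro order_tendstoD) auto
  have "\<forall>\<^sub>F b in nhds a. \<forall>b'. glpa_next b b' \<longrightarrow>
    norm (b' - b) \<le> \<kappa> * residual b \<and> residual b' \<le> M * residual b powr (2 / \<beta>)"
    using error_bound near_F near_norm small small_step small_J small_B
  proof eventually_elim
    case (elim b)
    show ?case
    proof (intro allI impI)
      fix b' assume "glpa_next b b'"
      then obtain d where d: "glpa_direction b d" and b': "if d = 0 then b' = b
        else \<exists>j. line_search_ok L F t c b d (\<tau> ^ j) \<and>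
               (\<forall>i<j. \<not> line_search_ok L F t c b d (\<tau> ^ i)) \<and> b' = b + \<tau> ^ j *\<^sub>R d"
        unfolding glpa_next_def by blast
      define D where "D = residual b"
      define z where "z = F b + J b d"
      have "D \<ge> 0" by (simp add: D_def infdist_nonneg)
      obtain d' where d': "F b + J b d' \<in> argmin_set L" "norm d' \<le> \<kappa> * D"
        using elim(1) unfolding D_def by blast
      have prox_le: "prox_model L F t b d \<le> Lmin + \<kappa>\<^sup>2 * D\<^sup>2 / (2 * t)"
      proof -
        have "prox_model L F t b d \<le> prox_model L F t b d'"
          using d by (rule glpa_directionD)
        also have "\<dots> = Lmin + (norm d')\<^sup>2 / (2 * t)"
          using d'(1) L_eq_Lmin_iff by (simp add: prox_model_def)
        also have "\<dots> \<le> Lmin + (\<kappa> * D)\<^sup>2 / (2 * t)"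
          using d'(2) t_pos by (intro add_left_mono divide_right_mono power_mono) auto
        finally show ?thesis by (simp add: power_mult_distrib)
      qed
      have d_le: "norm d \<le> \<kappa> * D"
      proof -
        have "(norm d)\<^sup>2 \<le> 2 * t * (prox_model L F t b d - Lmin)"
          by (rule norm_le_prox_model)
        also have "\<dots> \<le> 2 * t * (\<kappa>\<^sup>2 * D\<^sup>2 / (2 * t))"
          using prox_le t_pos by (intro mult_left_mono) auto
        also have "\<dots> = (\<kappa> * D)\<^sup>2"
          using t_pos by (simp add: power_mult_distrib)
        finally show ?thesis
          by (rule power2_le_imp_le) (use \<open>\<kappa> > 0\<close> \<open>D \<ge> 0\<close> in simp)
      qed
      then have d2_le: "(norm d)\<^sup>2 \<le> \<kappa>\<^sup>2 * D\<^sup>2"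
        using power_mono[OF d_le, of 2] by (simp add: power_mult_distrib)
      have "norm d \<le> 1" using d_le elim(5) by (simp add: D_def)
      have Lz_le: "L z \<le> Lmin + \<kappa>\<^sup>2 * D\<^sup>2 / (2 * t)"
      proof -
        have "L z \<le> prox_model L F t b d"
          using t_pos by (simp add: z_def prox_model_def)
        then show ?thesis using prox_le by linarith
      qed
      have "D\<^sup>2 = D powr \<beta> * D powr (2 - \<beta>)"
        using \<open>D \<ge> 0\<close> by (simp flip: powr_add)
      then have "B * D\<^sup>2 = (B * D powr (2 - \<beta>)) * D powr \<beta>"
        by simp
      also have "\<dots> \<le> ((1 - c) * \<alpha>) * D powr \<beta>"
        using elim(7) by (intro mult_right_mono) (auto simp: D_def)
      also have "\<dots> \<le> (1 - c) * (L (F b) - Lmin)"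
      proof -
        have "F b \<in> ball (F a) r"
          using elim(2) \<open>r > 0\<close> by (simp add: dist_commute)
        then have "\<alpha> * D powr \<beta> \<le> L (F b) - Lmin"
          using growth[of "F b"] by (simp add: D_def)
        then show ?thesis
          using c_bounds by (simp add: mult.assoc mult_left_mono)
      qed
      finally have BD: "B * D\<^sup>2 \<le> (1 - c) * (L (F b) - Lmin)" .
      \<comment> \<open>The gap after the step is at most \<open>B * D\<^sup>2\<close>, which
        \<open>BD\<close> bounds by the fraction \<open>1 - c\<close> of the current gap. The
        decrease is thus at least the fraction \<open>c\<close>, the most that the line search can
        demand.\<close>
      have "line_search_ok L F t c b d 1"
      proof -
        have "L (F (b + d)) \<le> L z + Q * (norm d)\<^sup>2"
          using Q[of b d] elim(3) \<open>norm d \<le> 1\<close> \<open>R \<ge> 1\<close> unfolding z_def by linarith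
        also have "\<dots> \<le> (Lmin + \<kappa>\<^sup>2 * D\<^sup>2 / (2 * t)) + Q * (\<kappa>\<^sup>2 * D\<^sup>2)"
          using Lz_le d2_le \<open>Q > 0\<close> by (intro add_mono mult_left_mono) auto
        also have "\<dots> = Lmin + B * D\<^sup>2"
          by (simp add: B_def algebra_simps)
        also have "\<dots> \<le> L (F b) + c * (Lmin - L (F b))"
          using BD by (simp add: algebra_simps)
        also have "\<dots> \<le> L (F b) + c * (prox_model L F t b d - L (F b))"
        proof -
          have "0 \<le> (norm d)\<^sup>2 / (2 * t)" using t_pos by simp
          then have "Lmin \<le> prox_model L F t b d"
            using Lmin_le[of "F b + J b d"] by (simp add: prox_model_def)
          then show ?thesis
            using c_bounds by (intro add_left_mono mult_left_mono) auto
        qed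
        finally show ?thesis
          by (simp add: line_search_ok_def)
      qed
      \<comment> \<open>\<open>\<tau> ^ 0 = 1\<close> is the first candidate, so minimality forces
        \<open>j = 0\<close>; for \<open>d = 0\<close> both forms agree.\<close>
      then have b'_eq: "b' = b + d"
        using b' by (cases "d = 0") (auto, metis gr0I power_0 scaleR_one)
      have "norm (b' - b) \<le> \<kappa> * residual b"
        using d_le by (simp add: b'_eq D_def)
      moreover have "residual b' \<le> M * residual b powr (2 / \<beta>)"
      proof -
        have "dist (F a) z < r"
        proof -
          have "norm (J b d) \<le> KJ * (\<kappa> * D)"
            using KJ[OF elim(3), of d] d_le \<open>KJ > 0\<close> by (auto intro: order_trans mult_left_mono)
          then have "dist (F b) z < r / 2"
            using elim(6) by (simp add: z_def dist_norm D_def)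
          then show ?thesis
            using elim(2) dist_triangle2[of "F a" z "F b"] by (simp add: dist_commute)
        qed
        then have "\<alpha> * infdist z (argmin_set L) powr \<beta> \<le> \<kappa>\<^sup>2 * D\<^sup>2 / (2 * t)"
          using growth[of z] Lz_le by simp
        then have "infdist z (argmin_set L) powr \<beta> \<le> A * D powr 2"
          using \<open>\<alpha> > 0\<close> t_pos \<open>D \<ge> 0\<close> by (simp add: A_def field_simps)
        \<comment> \<open>Taking the root of order \<open>\<beta>\<close> produces the rate
          \<open>2 / \<beta>\<close>.\<close>
        then have "(infdist z (argmin_set L) powr \<beta>) powr (1 / \<beta>) \<le> (A * D powr 2) powr (1 / \<beta>)"
          using \<beta> by (intro powr_mono2) auto
        then have z_res: "infdist z (argmin_set L) \<le> A powr (1 / \<beta>) * D powr (2 / \<beta>)"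
          using \<beta> \<open>A > 0\<close> by (simp add: powr_powr powr_mult infdist_nonneg)
        have "norm b \<le> 2 * R" "norm (b + d) \<le> 2 * R"
          using elim(3) \<open>norm d \<le> 1\<close> \<open>R \<ge> 1\<close> norm_triangle_ineq[of b d] by linarith+
        then have "dist (F b') z \<le> K * (norm d)\<^sup>2"
          unfolding b'_eq z_def dist_norm by (rule K)
        also have "\<dots> \<le> K * (\<kappa>\<^sup>2 * D\<^sup>2)"
          using d2_le \<open>K > 0\<close> by (intro mult_left_mono) auto
        also have "D\<^sup>2 \<le> D powr (2 / \<beta>)"
        proof -
          have "D powr 2 \<le> D powr (2 / \<beta>)"
            using \<beta> \<open>D \<ge> 0\<close> elim(4) by (intro powr_mono') (auto simp: D_def field_simps)
          then show ?thesis using \<open>D \<ge> 0\<close> by simp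
        qed
        finally have "dist (F b') z \<le> K * (\<kappa>\<^sup>2 * D powr (2 / \<beta>))"
          using \<open>K > 0\<close> by (simp add: mult_left_mono)
        with z_res show ?thesis
          using infdist_triangle[of "F b'" "argmin_set L" z] unfolding M_def D_def[symmetric]
          by (simp add: algebra_simps)
      qed
      ultimately show "norm (b' - b) \<le> \<kappa> * residual b \<and> residual b' \<le> M * residual b powr (2 / \<beta>)"
        by blast
    qed
  qed
  with \<open>\<kappa> > 0\<close> \<open>M > 0\<close> show thesis by (rule that)
qed

text \<open>Optimality of the cluster point comes first, since the local step estimate presupposes
  \<open>F a \<in> argmin_set L\<close>.\<close>

lemma glpa_converges_with_order:
  assumes run: "glpa_sequence L F t c \<tau> \<theta>"
    and s: "strict_mono s" and lim: "(\<theta> \<circ> s) \<longlonglongrightarrow> a"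
    and "r > 0" "\<beta> < 2"
    and sharp: "weak_sharp_minima L \<beta> (ball (F a) r \<union> argmin_set L)"
    and reg: "regular_point F (argmin_set L) a"
  shows "F a \<in> argmin_set L" "converges_with_order \<theta> a (2 / \<beta>)"
proof -
  have nxt: "glpa_next (\<theta> k) (\<theta> (Suc k))" for k
    using run unfolding glpa_sequence_def glpa_next_def by blast
  show Fa: "F a \<in> argmin_set L"
    by (intro regular_stationary_imp_argmin[OF reg] stationary_linearization_minimal
        cluster_point_stationary[OF nxt s lim])
  obtain \<alpha> where "\<alpha> > 0" "\<beta> \<ge> 1" and growth:
    "\<And>z. z \<in> ball (F a) r \<Longrightarrow> Lmin + \<alpha> * infdist z (argmin_set L) powr \<beta> \<le> L z"
    using sharp unfolding weak_sharp_minima_def by blast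
  obtain \<kappa> M where "\<kappa> > 0" "M > 0" and step: "\<forall>\<^sub>F b in nhds a. \<forall>b'. glpa_next b b' \<longrightarrow>
      norm (b' - b) \<le> \<kappa> * residual b \<and> residual b' \<le> M * residual b powr (2 / \<beta>)"
    using glpa_step_near_regular_minimum[OF reg Fa \<open>r > 0\<close> \<open>\<alpha> > 0\<close> \<open>\<beta> \<ge> 1\<close> \<open>\<beta> < 2\<close> growth]
    by blast
  obtain K where "K > 0" and K: "\<forall>\<^sub>F b in nhds a. residual b \<le> K * norm (b - a)"
    using residual_le[OF Fa] by blast
  show "converges_with_order \<theta> a (2 / \<beta>)"
  proof (rule converges_with_order_of_residual[OF s lim \<open>\<kappa> > 0\<close> \<open>M > 0\<close> \<open>K > 0\<close> _ _ K])
    show "1 < 2 / \<beta>" using \<open>\<beta> \<ge> 1\<close> \<open>\<beta> < 2\<close> by simp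
    show "0 \<le> residual b" for b by (rule infdist_nonneg)
    show "\<forall>\<^sub>F b in nhds a. \<forall>k. \<theta> k = b \<longrightarrow>
        norm (\<theta> (Suc k) - b) \<le> \<kappa> * residual b \<and> residual (\<theta> (Suc k)) \<le> M * residual b powr (2 / \<beta>)"
      using step by eventually_elim (use nxt in blast)
  qed
qed

end

section \<open>Specialization to sigmoid networks\<close>

theorem theorem5:
  fixes kind :: loss
    and x :: "'m::finite \<Rightarrow> real ^ 'd::finite" and y :: "'m \<Rightarrow> real"
    and F :: "('d, 'q::finite) params \<Rightarrow> real ^ 'm" and L :: "real ^ 'm \<Rightarrow> real"
    and t c \<tau> \<beta> r :: real
    and \<theta> :: "nat \<Rightarrow> ('d, 'q) params" and \<theta>star :: "('d, 'q) params"
  assumes F: "F = inner_fun kind x y" and L: "L = outer_fun kind"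
    and "t > 0" and "c \<in> {0<..<1}" and "\<tau> \<in> {0<..<1}"
    and "\<beta> \<in> {1..<2}" and "r > 0"
    and "glpa_sequence L F t c \<tau> \<theta>"
    and "\<exists>s. strict_mono s \<and> (\<theta> \<circ> s) \<longlonglongrightarrow> \<theta>star"
    and "weak_sharp_minima L \<beta> (ball (F \<theta>star) r \<union> argmin_set L)"
    and "regular_point F (argmin_set L) \<theta>star"
  shows "converges_with_order \<theta> \<theta>star (2 / \<beta>) \<and>
         is_arg_min (\<lambda>\<theta>'. L (F \<theta>')) (\<lambda>_. True) \<theta>star \<and>
         F \<theta>star \<in> argmin_set L"
proof -
  interpret composite_problem L F t c \<tau>
    using assms(3-5) unfolding F L
    by unfold_locales (auto intro: convex_on_outer_fun C11_inner_fun simp: argmin_set_outer_fun_nonempty)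
  obtain s where s: "strict_mono s" "(\<theta> \<circ> s) \<longlonglongrightarrow> \<theta>star"
    using assms(9) by blast
  have "\<beta> < 2" using assms(6) by simp
  note convergence = glpa_converges_with_order[OF assms(8) s \<open>r > 0\<close> this assms(10,11)]
  \<comment> \<open>\<open>F \<theta>star\<close> minimizes \<open>L\<close> over the whole space,
    in particular over the values of \<open>F\<close>.\<close>
  moreover have "is_arg_min (\<lambda>\<theta>'. L (F \<theta>')) (\<lambda>_. True) \<theta>star"
    using convergence(1) by (simp add: argmin_set_def is_arg_min_def)
  ultimately show ?thesis by blast
qed

end
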